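(* Let $H_i(x,p)=H_i(p)-f_i(x)$, $i=1,\dots,K$, satisfy assumptions (a), (b), (c) of the context, and let $\overline L_c$, $M$, $L_2$ and the numerical Hamiltonians $G_i$ with constants $L_G$ and $L_c\geq \overline L_c+1$ be as in the context. There is a constant $C>0$, depending only on $M$, $L_G$, $L_2$, $\overline L_c$ and the Lipschitz constant of each Hamiltonian $H_i$ in $\overline{I_i}\times[-(\overline L_c+1),\overline L_c+1]$, such that for all $\Delta x>0$ and $\epsilon>0$ with $$2L_G\Delta x\le\epsilon\le L_2\Delta x,$$ if $u$ is the unique bounded viscosity solution of $$u+H_i(x,u_{x_i})=0\ \text{ in }I_i\ (i=1,\dots,K),\qquad\sum_{i=1}^Ku_{x_i}=0\ \text{ on }\{0\},$$ and $U:\mathcal J\to\mathbb R$ is the unique bounded solution of $$U(m)+F_i(D^+U(m),D^-U(m))=f_i(-m\Delta x)\ \text{ for }m\in J_i\setminus\{0\},\qquad U(0)=\frac1K\sum_{i=1}^KU(1_i),$$ then $$\sup\{|U(m)-u(-m\Delta x)| : m\in\mathcal J\}\le C\,\Delta x^{1/2}.$$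
   Context: Junction: fix an integer $K\ge1$ and $K$ copies $I_1,\dots,I_K$ of $(-\infty,0)$. $\mathcal I=\bigcup_i\overline{I_i}$ is the union of the half-lines $\overline{I_i}=(-\infty,0]$ glued at $0$, with metric $d(x,y)=|x-y|$ on a common edge and $|x|+|y|$ otherwise. $\varphi_{x_i}$ is the derivative along $\overline{I_i}$ (one-sided at $0$); $C^2(\mathcal I)$ is the set of continuous functions whose restriction to each $\overline{I_i}$ is $C^2$. Hamiltonians (separated form $H_i(x,p)=H_i(p)-f_i(x)$): (a) for each $R>0$, $H_i(x,p)$ is uniformly Lipschitz on $\overline{I_i}\times[-R,R]$; (b) $\lim_{|p|\to\infty}H_i(x,p)=\infty$ uniformly in $x$; (c) $M:=\sup\{|H_i(x,0)| : x\in\overline{I_i},\,1\le i\le K\}<\infty$. Viscosity solution of the stationary problem: a continuous $u:\mathcal I\to\mathbb R$ such that for every $\varphi\in C^2(\mathcal I)$: if $u-\varphi$ has a local maximum at $x_0$, then $u(x_0)+H_i(x_0,\varphi_{x_i}(x_0))\le0$ when $x_0\in I_i$, and $\min\{\sum_i\varphi_{x_i}(0),u(0)+\min_iH_i(0,\varphi_{x_i}(0))\}\le0$ when $x_0=0$; if $u-\varphi$ has a local minimum at $x_0$, then $u(x_0)+H_i(x_0,\varphi_{x_i}(x_0))\ge0$ when $x_0\in I_i$, and $\max\{\sum_i\varphi_{x_i}(0),u(0)+\max_iH_i(0,\varphi_{x_i}(0))\}\ge0$ when $x_0=0$. Grid: $J_i=\{0,1,2,\dots\}$, where $m\in J_i$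 corresponds to $-m\Delta x\in\overline{I_i}$; $\mathcal J=\bigcup_iJ_i$ glued at $0$; $1_i$ is the point $1$ of $J_i$. On $J_i\setminus\{0\}$, $D^+U(m)=\frac{U(m-1)-U(m)}{\Delta x}$, $D^-U(m)=\frac{U(m)-U(m+1)}{\Delta x}$, and $F_i(p_1,p_2)=-\frac{\epsilon}{\Delta x}(p_1-p_2)+G_i(p_1,p_2)$. Numerical Hamiltonians: $G_i:\mathbb R^2\to\mathbb R$ is uniformly Lipschitz, and $G_i(p,p)=H_i(p)$ for $p\in[-L_c,L_c]$, $1\le i\le K$, for some $L_c>0$. $L_G=\max_i\sup\frac{|G_i(p_1,p_2)-G_i(q_1,q_2)|}{|p_1-q_1|+|p_2-q_2|}$. $L_2>0$ is a fixed constant. $\overline L_c>0$ is a constant chosen such that $H_i(p)\ge M+\sup_j\sup_x|f_j(x)|+1$ whenever $|p|\ge K^{-1}\overline L_c$ and $1\le i\le K$; when $L_c\ge\overline L_c$ and $\epsilon\ge2L_G\Delta x$, the scheme has a unique bounded solution $U$, with $\sup|U|\le M$ and $|U(m+1)-U(m)|\le\overline L_c\Delta x$ on each $J_i$. It is assumed that $L_c\ge\overline L_c+1$. *)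

theory Defs
  imports "HOL-Analysis.Analysis"
begin

text \<open>The edges are indexed by a finite type \<open>'k\<close>, so that \<open>K = CARD('k) \<ge> 1\<close>.
  The junction is \<open>'k \<times> (-\<infinity>, 0]\<close> with all the points \<open>(i, 0)\<close> identified.\<close>

definition junction_rel :: "'k \<times> real \<Rightarrow> 'k \<times> real \<Rightarrow> bool" where
  "junction_rel a b \<longleftrightarrow> snd a \<le> 0 \<and> snd b \<le> 0 \<and> (a = b \<or> snd a = 0 \<and> snd b = 0)"

quotient_type 'k junction = "'k \<times> real" / partial: junction_rel
proof (rule part_equivpI)
  show "\<exists>x::'k \<times> real. junction_rel x x"
    by (rule exI[of _ "(undefined, 0)"]) (simp add: junction_rel_def)
  show "symp (junction_rel :: 'k \<times> real \<Rightarrow> _)"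
    by (auto simp: symp_def junction_rel_def)
  show "transp (junction_rel :: 'k \<times> real \<Rightarrow> _)"
    by (auto simp: transp_def junction_rel_def)
qed

text \<open>The point at coordinate \<open>x \<le> 0\<close> of edge \<open>i\<close>. The truncation only serves to make the
  function total: it is never used at \<open>x > 0\<close>.\<close>

lift_definition edge_point :: "'k \<Rightarrow> real \<Rightarrow> 'k junction" is "\<lambda>i x. (i, min x 0)"
  by (simp add: junction_rel_def)

definition origin :: "'k junction" where
  "origin = edge_point undefined 0"

lemma edge_point_0: "edge_point i 0 = origin"
  unfolding origin_def by transfer (simp add: junction_rel_def)

lemma junction_cases: obtains i x where "x \<le> 0" "z = edge_point i x"
proof -
  have "\<exists>i x. x \<le> 0 \<and> z = edge_point i x"
  proof (transfer, goal_cases)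
    case (1 z)
    then show ?case
      by (intro exI[of _ "fst z"] exI[of _ "snd z"]) (auto simp: junction_rel_def min_def)
  qed
  then show thesis using that by blast
qed

lemma edge_point_eq_iff:
  assumes "x \<le> 0" "y \<le> 0"
  shows "edge_point i x = edge_point j y \<longleftrightarrow> i = j \<and> x = y \<or> x = 0 \<and> y = 0"
  using assms by transfer (auto simp: junction_rel_def)

instantiation junction :: (type) metric_space
begin

lift_definition dist_junction :: "'a junction \<Rightarrow> 'a junction \<Rightarrow> real" is
  "\<lambda>a b. if fst a = fst b then \<bar>snd a - snd b\<bar> else \<bar>snd a\<bar> + \<bar>snd b\<bar>"
  by (auto simp: junction_rel_def)

definition uniformity_junction :: "('a junction \<times> 'a junction) filter" where
  "uniformity_junction = (INF e\<in>{0<..}. principal {(x, y). dist x y < e})"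

definition open_junction :: "'a junction set \<Rightarrow> bool" where
  "open_junction U \<longleftrightarrow> (\<forall>x\<in>U. eventually (\<lambda>(x', y). x' = x \<longrightarrow> y \<in> U) uniformity)"

instance
proof
  fix a b c :: "'a junction"
  show "dist a b = 0 \<longleftrightarrow> a = b"
    by transfer (auto simp: junction_rel_def prod_eq_iff split: if_splits)
  show "dist a b \<le> dist a c + dist b c"
    by transfer (auto simp: junction_rel_def)
qed (simp_all add: uniformity_junction_def open_junction_def)

end

lemma dist_edge_point:
  assumes "x \<le> 0" "y \<le> 0"
  shows "dist (edge_point i x) (edge_point j y) = (if i = j then \<bar>x - y\<bar> else \<bar>x\<bar> + \<bar>y\<bar>)"
  using assms by transfer simp


definition C2_half_line :: "(real \<Rightarrow> real) \<Rightarrow> bool" where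
  "C2_half_line g \<longleftrightarrow> (\<exists>g' g''.
     (\<forall>x\<le>0. (g has_real_derivative g' x) (at x within {..0})) \<and>
     (\<forall>x\<le>0. (g' has_real_derivative g'' x) (at x within {..0})) \<and>
     continuous_on {..0} g'')"

definition C2_junction :: "('k junction \<Rightarrow> real) set" where
  "C2_junction = {\<phi>. continuous_on UNIV \<phi> \<and> (\<forall>i. C2_half_line (\<lambda>x. \<phi> (edge_point i x)))}"

definition edge_deriv :: "('k junction \<Rightarrow> real) \<Rightarrow> 'k \<Rightarrow> real \<Rightarrow> real" where
  "edge_deriv \<phi> i x = vector_derivative (\<lambda>y. \<phi> (edge_point i y)) (at x within {..0})"

definition local_max_at :: "('a::topological_space \<Rightarrow> real) \<Rightarrow> 'a \<Rightarrow> bool" where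
  "local_max_at g z \<longleftrightarrow> (\<forall>\<^sub>F y in nhds z. g y \<le> g z)"

definition local_min_at :: "('a::topological_space \<Rightarrow> real) \<Rightarrow> 'a \<Rightarrow> bool" where
  "local_min_at g z \<longleftrightarrow> (\<forall>\<^sub>F y in nhds z. g z \<le> g y)"

text \<open>A Hamiltonian is written \<open>h i x p\<close>, with edge \<open>i\<close>, coordinate \<open>x\<close> and slope \<open>p\<close>.\<close>

definition viscosity_subsolution ::
    "('k::finite \<Rightarrow> real \<Rightarrow> real \<Rightarrow> real) \<Rightarrow> ('k junction \<Rightarrow> real) \<Rightarrow> bool" where
  "viscosity_subsolution h u \<longleftrightarrow> continuous_on UNIV u \<and> (\<forall>\<phi>\<in>C2_junction.
     (\<forall>i. \<forall>x<0. local_max_at (\<lambda>z. u z - \<phi> z) (edge_point i x) \<longrightarrow>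
        u (edge_point i x) + h i x (edge_deriv \<phi> i x) \<le> 0) \<and>
     (local_max_at (\<lambda>z. u z - \<phi> z) origin \<longrightarrow>
        min (\<Sum>i\<in>UNIV. edge_deriv \<phi> i 0)
            (u origin + (MIN i. h i 0 (edge_deriv \<phi> i 0))) \<le> 0))"

definition viscosity_supersolution ::
    "('k::finite \<Rightarrow> real \<Rightarrow> real \<Rightarrow> real) \<Rightarrow> ('k junction \<Rightarrow> real) \<Rightarrow> bool" where
  "viscosity_supersolution h u \<longleftrightarrow> continuous_on UNIV u \<and> (\<forall>\<phi>\<in>C2_junction.
     (\<forall>i. \<forall>x<0. local_min_at (\<lambda>z. u z - \<phi> z) (edge_point i x) \<longrightarrow>
        u (edge_point i x) + h i x (edge_deriv \<phi> i x) \<ge> 0) \<and>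
     (local_min_at (\<lambda>z. u z - \<phi> z) origin \<longrightarrow>
        max (\<Sum>i\<in>UNIV. edge_deriv \<phi> i 0)
            (u origin + (MAX i. h i 0 (edge_deriv \<phi> i 0))) \<ge> 0))"

definition viscosity_solution ::
    "('k::finite \<Rightarrow> real \<Rightarrow> real \<Rightarrow> real) \<Rightarrow> ('k junction \<Rightarrow> real) \<Rightarrow> bool" where
  "viscosity_solution h u \<longleftrightarrow> viscosity_subsolution h u \<and> viscosity_supersolution h u"


definition separated :: "('k \<Rightarrow> real \<Rightarrow> real) \<Rightarrow> ('k \<Rightarrow> real \<Rightarrow> real) \<Rightarrow> 'k \<Rightarrow> real \<Rightarrow> real \<Rightarrow> real" where
  "separated H f i x p = H i p - f i x"

definition locally_lipschitz_hamiltonians :: "('k \<Rightarrow> real \<Rightarrow> real \<Rightarrow> real) \<Rightarrow> bool" where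
  "locally_lipschitz_hamiltonians h \<longleftrightarrow>
     (\<forall>R>0. \<forall>i. \<exists>L. L-lipschitz_on ({..0} \<times> {-R..R}) (\<lambda>(x, p). h i x p))"

definition coercive_hamiltonians :: "('k \<Rightarrow> real \<Rightarrow> real \<Rightarrow> real) \<Rightarrow> bool" where
  "coercive_hamiltonians h \<longleftrightarrow>
     (\<forall>i A. \<exists>R. \<forall>p. \<bar>p\<bar> \<ge> R \<longrightarrow> (\<forall>x\<le>0. h i x p \<ge> A))"

definition zero_slope_values :: "('k \<Rightarrow> real \<Rightarrow> real \<Rightarrow> real) \<Rightarrow> real set" where
  "zero_slope_values h = {\<bar>h i x 0\<bar> |i x. x \<le> 0}"

definition source_sup :: "('k \<Rightarrow> real \<Rightarrow> real) \<Rightarrow> real" where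
  "source_sup f = Sup {\<bar>f j x\<bar> |j x. x \<le> 0}"

definition lipschitz_const :: "'a::metric_space set \<Rightarrow> ('a \<Rightarrow> 'b::metric_space) \<Rightarrow> real" where
  "lipschitz_const X g = Inf {L. L-lipschitz_on X g}"

definition numerical_lipschitz_const :: "('k::finite \<Rightarrow> real \<Rightarrow> real \<Rightarrow> real) \<Rightarrow> real" where
  "numerical_lipschitz_const G = (MAX i. Sup {\<bar>G i p1 p2 - G i q1 q2\<bar> / (\<bar>p1 - q1\<bar> + \<bar>p2 - q2\<bar>)
      |p1 p2 q1 q2. (p1, p2) \<noteq> (q1, q2)})"


text \<open>Node \<open>m\<close> of edge \<open>i\<close> has coordinate \<open>-m \<Delta>x\<close>; the nodes \<open>(i, 0)\<close> are identified.\<close>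

definition grid_rel :: "'k \<times> nat \<Rightarrow> 'k \<times> nat \<Rightarrow> bool" where
  "grid_rel a b \<longleftrightarrow> a = b \<or> snd a = 0 \<and> snd b = 0"

quotient_type 'k grid = "'k \<times> nat" / grid_rel
  by (rule equivpI) (auto simp: reflp_def symp_def transp_def grid_rel_def)

lift_definition node :: "'k \<Rightarrow> nat \<Rightarrow> 'k grid" is Pair .

definition grid_origin :: "'k grid" where
  "grid_origin = node undefined 0"

lemma node_0: "node i 0 = grid_origin"
  unfolding grid_origin_def by transfer (simp add: grid_rel_def)

lemma grid_cases: obtains i m where "z = node i m"
proof -
  have "\<exists>i m. z = node i m"
    by transfer (auto simp: grid_rel_def)
  then show thesis using that by blast
qed

lemma node_eq_iff: "node i m = node j n \<longleftrightarrow> i = j \<and> m = n \<or> m = 0 \<and> n = 0"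
  by transfer (auto simp: grid_rel_def)

text \<open>The difference quotients and the scheme are only used at nodes \<open>m \<ge> 1\<close>.\<close>

definition diff_plus :: "real \<Rightarrow> ('k grid \<Rightarrow> real) \<Rightarrow> 'k \<Rightarrow> nat \<Rightarrow> real" where
  "diff_plus \<Delta>x U i m = (U (node i (m - 1)) - U (node i m)) / \<Delta>x"

definition diff_minus :: "real \<Rightarrow> ('k grid \<Rightarrow> real) \<Rightarrow> 'k \<Rightarrow> nat \<Rightarrow> real" where
  "diff_minus \<Delta>x U i m = (U (node i m) - U (node i (m + 1))) / \<Delta>x"

definition numerical_flux ::
    "real \<Rightarrow> real \<Rightarrow> ('k \<Rightarrow> real \<Rightarrow> real \<Rightarrow> real) \<Rightarrow> 'k \<Rightarrow> real \<Rightarrow> real \<Rightarrow> real" where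
  "numerical_flux \<Delta>x \<epsilon> G i p1 p2 = - (\<epsilon> / \<Delta>x) * (p1 - p2) + G i p1 p2"

definition scheme_solution ::
    "real \<Rightarrow> real \<Rightarrow> ('k::finite \<Rightarrow> real \<Rightarrow> real \<Rightarrow> real) \<Rightarrow> ('k \<Rightarrow> real \<Rightarrow> real) \<Rightarrow>
     ('k grid \<Rightarrow> real) \<Rightarrow> bool" where
  "scheme_solution \<Delta>x \<epsilon> G f U \<longleftrightarrow>
     (\<forall>i. \<forall>m\<ge>1. U (node i m)
         + numerical_flux \<Delta>x \<epsilon> G i (diff_plus \<Delta>x U i m) (diff_minus \<Delta>x U i m)
         = f i (- real m * \<Delta>x)) \<and>
     U grid_origin = (1 / real CARD('k)) * (\<Sum>i\<in>UNIV. U (node i 1))"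

text \<open>The standing assumptions on the data, with the constants on which the error bound may depend
  as explicit parameters: \<open>\<Lambda> i\<close> is the Lipschitz constant of the \<open>i\<close>-th Hamiltonian on
  \<open>(-\<infinity>, 0] \<times> [-(Lbar + 1), Lbar + 1]\<close>.\<close>

definition admissible_data ::
    "real \<Rightarrow> real \<Rightarrow> real \<Rightarrow> ('k::finite \<Rightarrow> real) \<Rightarrow> ('k \<Rightarrow> real \<Rightarrow> real) \<Rightarrow> ('k \<Rightarrow> real \<Rightarrow> real) \<Rightarrow>
     ('k \<Rightarrow> real \<Rightarrow> real \<Rightarrow> real) \<Rightarrow> real \<Rightarrow> bool" where
  "admissible_data M L\<^sub>G Lbar \<Lambda> H f G L\<^sub>c \<longleftrightarrow>
     locally_lipschitz_hamiltonians (separated H f) \<and>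
     coercive_hamiltonians (separated H f) \<and>
     bdd_above (zero_slope_values (separated H f)) \<and>
     M = Sup (zero_slope_values (separated H f)) \<and>
     (\<forall>i p. \<bar>p\<bar> \<ge> Lbar / real CARD('k) \<longrightarrow> H i p \<ge> M + source_sup f + 1) \<and>
     (\<forall>i. \<Lambda> i = lipschitz_const ({..0} \<times> {-(Lbar + 1)..Lbar + 1})
                   (\<lambda>(x, p). separated H f i x p)) \<and>
     (\<forall>i. \<exists>L. L-lipschitz_on UNIV (\<lambda>(p1, p2). G i p1 p2)) \<and>
     L\<^sub>G = numerical_lipschitz_const G \<and>
     L\<^sub>c > 0 \<and> L\<^sub>c \<ge> Lbar + 1 \<and>
     (\<forall>i. \<forall>p\<in>{-L\<^sub>c..L\<^sub>c}. G i p p = H i p)"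

end

theory Submission
  imports Defs
begin

text \<open>
  The estimate follows from doubling of variables, with the penalty \<open>(x - y)\<^sup>2 / (2 * \<delta>)\<close> at scale
  \<open>\<delta> = sqrt \<Delta>x\<close>. Where the maximum of the doubled function lies inside an edge in both variables, the
  equation for \<open>u\<close> and the scheme for \<open>U\<close> are compared at the same slope, and consistency of the
  scheme costs an error of order \<open>\<delta>\<close>, as in the classical theory. The difficulty is the vertex, where
  the Kirchhoff condition couples the edges.

  At the vertex the edges are treated one at a time, with a penalty tilted by a linear term
  \<open>s * (x - y)\<close>. The tilt \<open>s\<close> is chosen slightly below the first difference quotient \<open>p\<^sub>1\<close> of \<open>U\<close> on
  that edge. This forces the maximum to have \<open>y\<close> away from the vertex. If \<open>x\<close> is also away from it, the
  classical argument applies. Otherwise (lemma \<open>edge_alternative\<close>) the maximum yields a slope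
  \<open>p > p\<^sub>1\<close> such that a parabola of slope \<open>p\<close> touches \<open>u\<close> from above at the vertex along the edge,
  while the scheme forces \<open>H i p \<ge> f i 0 - U 0 - O(\<delta>)\<close>. If this occurs on all edges, the parabolas
  form a test function for \<open>u\<close> at the vertex. Its slopes have a positive sum, because the quotients
  \<open>p\<^sub>1\<close> sum to zero by the discrete Kirchhoff condition; hence the subsolution property gives
  \<open>u 0 + H i p \<le> f i 0\<close> on some edge, and \<open>u 0 - U 0 = O(\<delta>)\<close> (lemma \<open>vertex_gap\<close>). Applied at an arbitrary
  node, the same alternative then bounds \<open>u - U\<close> everywhere.

  Every slope in this argument is controlled by the difference quotients of \<open>U\<close>, which coercivity
  bounds by comparison of \<open>U\<close> with piecewise linear barriers (lemma \<open>linear_growth\<close>). The argument is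
  symmetric under change of sign, so the bound on \<open>U - u\<close> comes from the same lemmas.
\<close>

section \<open>Quadratic test functions on the junction\<close>

text \<open>The coordinate along one edge, extended by \<open>0\<close> to the other edges. It is 1-Lipschitz for the
  junction metric, so that polynomials in these coordinates are continuous on the junction.\<close>

lift_definition arm_coord :: "'k \<Rightarrow> 'k junction \<Rightarrow> real" is
  "\<lambda>i z. if fst z = i then snd z else 0"
  by (auto simp: junction_rel_def)

lemma arm_coord_edge_point:
  "x \<le> 0 \<Longrightarrow> arm_coord i (edge_point j x) = (if j = i then x else 0)"
  by transfer simp

lemma continuous_on_arm_coord [continuous_intros]: "continuous_on A (arm_coord i)"
proof -
  have "dist (arm_coord i z) (arm_coord i w) \<le> dist z w" for z w :: "'a junction"
    unfolding dist_real_def by transfer (auto simp: junction_rel_def)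
  then have "1-lipschitz_on A (arm_coord i)"
    by (auto intro: lipschitz_onI)
  then show ?thesis by (rule lipschitz_on_continuous_on)
qed

definition quadratic_test :: "('k::finite \<Rightarrow> real) \<Rightarrow> ('k \<Rightarrow> real) \<Rightarrow> 'k junction \<Rightarrow> real" where
  "quadratic_test a b z = (\<Sum>i\<in>UNIV. a i * arm_coord i z + b i * (arm_coord i z)\<^sup>2)"

lemma quadratic_test_edge_point:
  assumes "x \<le> 0"
  shows "quadratic_test a b (edge_point i x) = a i * x + b i * x\<^sup>2"
proof -
  have "quadratic_test a b (edge_point i x) = (\<Sum>j\<in>UNIV. if j = i then a i * x + b i * x\<^sup>2 else 0)"
    unfolding quadratic_test_def using assms
    by (intro sum.cong) (auto simp: arm_coord_edge_point)
  then show ?thesis by simp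
qed

lemma quadratic_test_origin: "quadratic_test a b origin = 0"
  using quadratic_test_edge_point[of 0 a b undefined] by (simp add: edge_point_0)

lemma quadratic_test_deriv:
  assumes "x \<le> 0"
  shows "((\<lambda>y. quadratic_test a b (edge_point i y)) has_real_derivative a i + 2 * b i * x)
           (at x within {..0})"
proof -
  have "((\<lambda>y. a i * y + b i * y\<^sup>2) has_real_derivative a i + 2 * b i * x) (at x within {..0})"
    by (auto intro!: derivative_eq_intros)
  then show ?thesis
    by (rule has_field_derivative_transform_within[OF _ zero_less_one])
      (use assms in \<open>auto simp: quadratic_test_edge_point\<close>)
qed

lemma quadratic_test_C2: "quadratic_test a b \<in> C2_junction"
proof -
  have "continuous_on UNIV (quadratic_test a b)"
    unfolding quadratic_test_def by (intro continuous_intros)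
  moreover have "C2_half_line (\<lambda>x. quadratic_test a b (edge_point i x))" for i
    unfolding C2_half_line_def
    by (intro exI[of _ "\<lambda>x. a i + 2 * b i * x"] exI[of _ "\<lambda>x. 2 * b i"])
      (auto intro!: derivative_eq_intros simp: quadratic_test_deriv)
  ultimately show ?thesis by (simp add: C2_junction_def)
qed

text \<open>The one-sided derivative is unique because every \<open>x \<le> 0\<close> is a limit point of the half-line.\<close>

lemma edge_deriv_eqI:
  assumes "x \<le> 0" "((\<lambda>y. \<phi> (edge_point i y)) has_real_derivative d) (at x within {..0})"
  shows "edge_deriv \<phi> i x = d"
proof -
  have "{..<x} \<subseteq> {..0}"
    using assms(1) by auto
  moreover have "x islimpt {..<x}"
    by (simp add: islimpt_in_closure)
  ultimately have "at x within {..0} \<noteq> bot"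
    using islimpt_subset by (auto simp: trivial_limit_within)
  then show ?thesis
    unfolding edge_deriv_def using assms(2)
    by (intro vector_derivative_within) (auto simp: has_real_derivative_iff_has_vector_derivative)
qed

lemma edge_deriv_quadratic_test: "x \<le> 0 \<Longrightarrow> edge_deriv (quadratic_test a b) i x = a i + 2 * b i * x"
  by (rule edge_deriv_eqI) (auto simp: quadratic_test_deriv)

text \<open>The ball of radius \<open>\<bar>x\<bar>\<close> around an interior point does not reach the vertex, hence not the other
  edges either. Maximality along one edge is therefore enough for a local maximum on the junction.\<close>

lemma eventually_nhds_edge_point:
  assumes "x < 0"
  shows "\<forall>\<^sub>F z in nhds (edge_point i x). \<exists>y\<le>0. z = edge_point i y"
proof -
  have "\<exists>y\<le>0. z = edge_point i y" if "dist z (edge_point i x) < - x" for z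
  proof -
    obtain j y where y: "y \<le> 0" "z = edge_point j y" by (rule junction_cases)
    then have "j = i" using that assms by (auto simp: dist_edge_point split: if_splits)
    then show ?thesis using y by blast
  qed
  then show ?thesis
    unfolding eventually_nhds_metric using assms by (intro exI[of _ "- x"]) auto
qed

section \<open>Viscosity subsolutions tested with quadratics\<close>

lemma subsolution_interior:
  assumes sub: "viscosity_subsolution (separated H f) u" and "x < 0"
    and max: "\<And>y. y \<le> 0 \<Longrightarrow> u (edge_point i y) - (a * y + b * y\<^sup>2)
                           \<le> u (edge_point i x) - (a * x + b * x\<^sup>2)"
  shows "u (edge_point i x) + H i (a + 2 * b * x) \<le> f i x"
proof -
  let ?\<phi> = "quadratic_test (\<lambda>_. a) (\<lambda>_. b)"
  have "local_max_at (\<lambda>z. u z - ?\<phi> z) (edge_point i x)"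
    unfolding local_max_at_def using eventually_nhds_edge_point[OF \<open>x < 0\<close>, of i]
    by eventually_elim (use max \<open>x < 0\<close> in \<open>auto simp: quadratic_test_edge_point\<close>)
  then have "u (edge_point i x) + separated H f i x (edge_deriv ?\<phi> i x) \<le> 0"
    using sub \<open>x < 0\<close> quadratic_test_C2 unfolding viscosity_subsolution_def by blast
  then show ?thesis
    using \<open>x < 0\<close> by (simp add: edge_deriv_quadratic_test separated_def)
qed

text \<open>When the slopes of the test function have a positive sum, the Kirchhoff alternative of the vertex
  condition is excluded and the equation must hold on some edge. The global comparison produces
  exactly such slopes.\<close>

lemma subsolution_vertex:
  fixes H :: "'k::finite \<Rightarrow> real \<Rightarrow> real"
  assumes sub: "viscosity_subsolution (separated H f) u"
    and max: "\<And>i y. y \<le> 0 \<Longrightarrow> u (edge_point i y) \<le> u origin + a i * y + b i * y\<^sup>2"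
    and pos: "(\<Sum>i\<in>UNIV. a i) > 0"
  obtains i where "u origin + H i (a i) \<le> f i 0"
proof -
  let ?\<phi> = "quadratic_test a b"
  let ?h = "\<lambda>i. separated H f i 0 (a i)"
  have "u z - ?\<phi> z \<le> u origin - ?\<phi> origin" for z
  proof -
    obtain i y where y: "y \<le> 0" "z = edge_point i y" by (rule junction_cases)
    show ?thesis
      using max[OF y(1), of i] y by (simp add: quadratic_test_edge_point quadratic_test_origin)
  qed
  then have "local_max_at (\<lambda>z. u z - ?\<phi> z) origin"
    unfolding local_max_at_def by simp
  then have "min (\<Sum>i\<in>UNIV. edge_deriv ?\<phi> i 0)
      (u origin + (MIN i. separated H f i 0 (edge_deriv ?\<phi> i 0))) \<le> 0"
    using sub quadratic_test_C2 unfolding viscosity_subsolution_def by blast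
  then have "u origin + (MIN i. ?h i) \<le> 0"
    using pos by (simp add: edge_deriv_quadratic_test min_le_iff_disj)
  moreover have "(MIN i. ?h i) \<in> range ?h"
    by (intro Min_in) auto
  then obtain i where "(MIN i. ?h i) = ?h i" by (rule rangeE)
  ultimately have "u origin + ?h i \<le> 0" by simp
  then show thesis using that[of i] by (simp add: separated_def)
qed

lemma local_min_at_uminus: "local_min_at g z \<longleftrightarrow> local_max_at (\<lambda>y. - g y) z"
  by (simp add: local_min_at_def local_max_at_def)

lemma C2_junction_uminus:
  assumes "\<phi> \<in> C2_junction"
  shows "(\<lambda>z. - \<phi> z) \<in> C2_junction"
proof -
  have "C2_half_line (\<lambda>x. - g x)" if g: "C2_half_line g" for g
  proof -
    obtain g' g'' where
      "\<And>x. x \<le> 0 \<Longrightarrow> (g has_real_derivative g' x) (at x within {..0})"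
      "\<And>x. x \<le> 0 \<Longrightarrow> (g' has_real_derivative g'' x) (at x within {..0})"
      "continuous_on {..0} g''"
      using g unfolding C2_half_line_def by blast
    then show ?thesis
      unfolding C2_half_line_def
      by (intro exI[of _ "\<lambda>x. - g' x"] exI[of _ "\<lambda>x. - g'' x"])
        (auto intro!: derivative_eq_intros continuous_intros)
  qed
  then show ?thesis
    using assms by (auto simp: C2_junction_def intro: continuous_intros)
qed

lemma edge_deriv_uminus:
  assumes "\<phi> \<in> C2_junction" "x \<le> 0"
  shows "edge_deriv (\<lambda>z. - \<phi> z) i x = - edge_deriv \<phi> i x"
proof -
  obtain d where d: "((\<lambda>y. \<phi> (edge_point i y)) has_real_derivative d) (at x within {..0})"
    using assms unfolding C2_junction_def C2_half_line_def by blast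
  show ?thesis
    using edge_deriv_eqI[OF assms(2) d] edge_deriv_eqI[OF assms(2) DERIV_minus[OF d]] by simp
qed

lemma MIN_uminus:
  fixes g :: "'k::finite \<Rightarrow> real"
  shows "(MIN i. - g i) = - (MAX i. g i)"
proof (rule Min_eqI)
  show "- (MAX i. g i) \<in> range (\<lambda>i. - g i)"
  proof -
    have "(MAX i. g i) \<in> range g" by (intro Max_in) auto
    then obtain i where "(MAX i. g i) = g i" by (rule rangeE)
    then show ?thesis by simp
  qed
qed auto

lemma supersolution_edgeD:
  assumes "viscosity_supersolution h u" "\<phi> \<in> C2_junction" "x < 0"
    "local_min_at (\<lambda>z. u z - \<phi> z) (edge_point i x)"
  shows "u (edge_point i x) + h i x (edge_deriv \<phi> i x) \<ge> 0"
  using assms unfolding viscosity_supersolution_def by blast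

lemma supersolution_vertexD:
  assumes "viscosity_supersolution h u" "\<phi> \<in> C2_junction"
    "local_min_at (\<lambda>z. u z - \<phi> z) origin"
  shows "max (\<Sum>i\<in>UNIV. edge_deriv \<phi> i 0) (u origin + (MAX i. h i 0 (edge_deriv \<phi> i 0))) \<ge> 0"
  using assms unfolding viscosity_supersolution_def by blast

text \<open>Change of sign exchanges the two halves of the definition of a viscosity solution, including the
  \<open>min\<close> and \<open>max\<close> at the vertex. A bound from above for \<open>U - u\<close> therefore
  follows from one for subsolutions.\<close>

lemma supersolution_uminus:
  fixes H :: "'k::finite \<Rightarrow> real \<Rightarrow> real"
  assumes "viscosity_supersolution (separated H f) u"
  shows "viscosity_subsolution (separated (\<lambda>i p. - H i (- p)) (\<lambda>i x. - f i x)) (\<lambda>z. - u z)"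
  unfolding viscosity_subsolution_def
proof (intro conjI ballI allI impI)
  show "continuous_on UNIV (\<lambda>z. - u z)"
    using assms by (auto simp: viscosity_supersolution_def intro: continuous_intros)
next
  fix \<phi> :: "'k junction \<Rightarrow> real" and i x
  assume \<phi>: "\<phi> \<in> C2_junction" and x: "x < 0"
    and m: "local_max_at (\<lambda>z. - u z - \<phi> z) (edge_point i x)"
  have "local_min_at (\<lambda>z. u z - - \<phi> z) (edge_point i x)"
    using m by (simp add: local_min_at_uminus)
  then have "u (edge_point i x) + separated H f i x (edge_deriv (\<lambda>z. - \<phi> z) i x) \<ge> 0"
    by (rule supersolution_edgeD[OF assms C2_junction_uminus[OF \<phi>] x])
  then show "- u (edge_point i x)
      + separated (\<lambda>i p. - H i (- p)) (\<lambda>i x. - f i x) i x (edge_deriv \<phi> i x) \<le> 0"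
    using edge_deriv_uminus[OF \<phi>, of x i] x by (simp add: separated_def)
next
  fix \<phi> :: "'k junction \<Rightarrow> real"
  assume \<phi>: "\<phi> \<in> C2_junction" and m: "local_max_at (\<lambda>z. - u z - \<phi> z) origin"
  let ?d = "\<lambda>i. edge_deriv \<phi> i 0"
  have "local_min_at (\<lambda>z. u z - - \<phi> z) origin"
    using m by (simp add: local_min_at_uminus)
  then have "max (\<Sum>i\<in>UNIV. edge_deriv (\<lambda>z. - \<phi> z) i 0)
      (u origin + (MAX i. separated H f i 0 (edge_deriv (\<lambda>z. - \<phi> z) i 0))) \<ge> 0"
    by (rule supersolution_vertexD[OF assms C2_junction_uminus[OF \<phi>]])
  then have "max (- (\<Sum>i\<in>UNIV. ?d i)) (u origin + (MAX i. separated H f i 0 (- ?d i))) \<ge> 0"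
    using edge_deriv_uminus[OF \<phi>, of 0] by (simp add: sum_negf)
  moreover have "(MIN i. separated (\<lambda>i p. - H i (- p)) (\<lambda>i x. - f i x) i 0 (?d i))
      = - (MAX i. separated H f i 0 (- ?d i))"
    by (simp add: MIN_uminus[symmetric] separated_def add.commute)
  ultimately show "min (\<Sum>i\<in>UNIV. ?d i)
      (- u origin + (MIN i. separated (\<lambda>i p. - H i (- p)) (\<lambda>i x. - f i x) i 0 (?d i))) \<le> 0"
    unfolding le_max_iff_disj min_le_iff_disj by linarith
qed

section \<open>The finite difference scheme\<close>

text \<open>The condition \<open>L * \<Delta>x \<le> \<epsilon>\<close> makes the artificial viscosity dominate the slopes of \<open>G\<close>, so that the
  flux is monotone. No relation between \<open>G\<close> and a Hamiltonian is built in: this keeps the class of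
  schemes closed under change of sign.\<close>

locale monotone_scheme =
  fixes \<Delta>x \<epsilon> L :: real and G :: "'k::finite \<Rightarrow> real \<Rightarrow> real \<Rightarrow> real" and f :: "'k \<Rightarrow> real \<Rightarrow> real"
    and U :: "'k grid \<Rightarrow> real"
  assumes \<Delta>x: "\<Delta>x > 0"
    and G_lipschitz: "\<bar>G i p1 p2 - G i q1 q2\<bar> \<le> L * (\<bar>p1 - q1\<bar> + \<bar>p2 - q2\<bar>)"
    and viscosity: "L * \<Delta>x \<le> \<epsilon>"
    and scheme: "scheme_solution \<Delta>x \<epsilon> G f U"
    and bounded: "bounded (range U)"
begin

lemma L_nonneg: "L \<ge> 0"
  using G_lipschitz[of undefined 1 0 0 0] by simp

lemma node_le_0: "- real m * \<Delta>x \<le> 0"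
  using \<Delta>x by (simp add: mult_le_0_iff)

lemma flux_mono:
  assumes "q1 \<le> p1" "p2 \<le> q2"
  shows "numerical_flux \<Delta>x \<epsilon> G i p1 p2 \<le> numerical_flux \<Delta>x \<epsilon> G i q1 q2"
proof -
  define c where "c = \<epsilon> / \<Delta>x"
  have "L \<le> c"
    using viscosity \<Delta>x by (simp add: c_def field_simps)
  then have "L * ((p1 - q1) + (q2 - p2)) \<le> c * ((p1 - q1) + (q2 - p2))"
    using assms by (intro mult_right_mono) auto
  moreover have "\<bar>G i p1 p2 - G i q1 q2\<bar> \<le> L * ((p1 - q1) + (q2 - p2))"
    using G_lipschitz[of i p1 p2 q1 q2] assms by simp
  ultimately show ?thesis
    unfolding numerical_flux_def c_def[symmetric] by (simp add: algebra_simps abs_le_iff)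
qed

lemma flux_diagonal: "numerical_flux \<Delta>x \<epsilon> G i p p = G i p p"
  by (simp add: numerical_flux_def)

lemma scheme_edge:
  "m \<ge> 1 \<Longrightarrow> U (node i m)
     + numerical_flux \<Delta>x \<epsilon> G i (diff_plus \<Delta>x U i m) (diff_minus \<Delta>x U i m) = f i (- real m * \<Delta>x)"
  using scheme by (simp add: scheme_solution_def)

lemma kirchhoff: "(\<Sum>i\<in>UNIV. U grid_origin - U (node i 1)) = 0"
  using scheme by (simp add: scheme_solution_def sum_subtractf field_simps)

text \<open>The grid is infinite, so suprema of bounded functions need not be attained; subtracting a barrier
  that tends to infinity repairs this.\<close>

lemma exists_max_minus_proper:
  assumes proper: "\<And>c. \<exists>N. \<forall>i. \<forall>m>N. V i m \<ge> c"
  obtains j m where "\<And>i n. U (node i n) - V i n \<le> U (node j m) - V j m"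
proof -
  obtain B where B: "\<And>z. \<bar>U z\<bar> \<le> B"
    using bounded by (auto simp: bounded_iff)
  define g where "g = (\<lambda>(i, n). U (node i n) - V i n)"
  obtain N where N: "\<And>i m. m > N \<Longrightarrow> V i m \<ge> B - g (undefined, 0)"
    using proper by blast
  have "\<exists>z\<in>UNIV \<times> {..N}. \<forall>w\<in>UNIV \<times> {..N}. g w \<le> g z"
  proof -
    have "Max (g ` (UNIV \<times> {..N})) \<in> g ` (UNIV \<times> {..N})"
      by (intro Max_in) auto
    then obtain z where z: "z \<in> UNIV \<times> {..N}" "Max (g ` (UNIV \<times> {..N})) = g z"
      by (rule imageE) simp
    have "g w \<le> g z" if "w \<in> UNIV \<times> {..N}" for w
      unfolding z(2)[symmetric] using that by (intro Max_ge) auto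
    then show ?thesis using z(1) by blast
  qed
  then obtain z where z: "\<And>w. w \<in> UNIV \<times> {..N} \<Longrightarrow> g w \<le> g z" by blast
  have "g (i, n) \<le> g z" for i n
  proof (cases "n \<le> N")
    case False
    then have "g (i, n) \<le> g (undefined, 0)"
      using N[of n i] B[of "node i n"] by (simp add: g_def)
    also have "\<dots> \<le> g z" by (rule z) simp
    finally show ?thesis .
  qed (simp add: z)
  then show thesis
    using that[of "fst z" "snd z"] by (simp add: g_def case_prod_beta)
qed

text \<open>A function that touches \<open>U\<close> from above has a larger difference quotient towards the vertex and a
  smaller one away from it, so monotonicity of the flux turns the scheme for \<open>U\<close> into an inequality for the quotients of \<open>V\<close>.\<close>

lemma touching_edge:
  assumes max: "\<And>n. U (node i n) - V n \<le> U (node i m) - V m" and "m \<ge> 1"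
  shows "U (node i m) + numerical_flux \<Delta>x \<epsilon> G i ((V (m - 1) - V m) / \<Delta>x) ((V m - V (m + 1)) / \<Delta>x)
           \<le> f i (- real m * \<Delta>x)"
proof -
  have "diff_plus \<Delta>x U i m \<le> (V (m - 1) - V m) / \<Delta>x"
    unfolding diff_plus_def using max[of "m - 1"] \<Delta>x by (intro divide_right_mono) auto
  moreover have "(V m - V (m + 1)) / \<Delta>x \<le> diff_minus \<Delta>x U i m"
    unfolding diff_minus_def using max[of "m + 1"] \<Delta>x by (intro divide_right_mono) auto
  ultimately show ?thesis
    using flux_mono[of "diff_plus \<Delta>x U i m" "(V (m - 1) - V m) / \<Delta>x"
        "(V m - V (m + 1)) / \<Delta>x" "diff_minus \<Delta>x U i m" i] scheme_edge[OF \<open>m \<ge> 1\<close>, of i]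
    by linarith
qed

text \<open>The discrete Kirchhoff condition says that the outgoing differences sum to zero. Hence a barrier
  whose differences have a positive sum cannot touch \<open>U\<close> from above at the vertex.\<close>

lemma touching_vertex:
  assumes max: "\<And>i. U (node i 1) - V i \<le> U grid_origin - c"
  shows "(\<Sum>i\<in>UNIV. c - V i) \<le> 0"
proof -
  have "(\<Sum>i\<in>UNIV. c - V i) \<le> (\<Sum>i\<in>UNIV. U grid_origin - U (node i 1))"
    by (intro sum_mono) (use max in \<open>simp add: algebra_simps\<close>)
  then show ?thesis using kirchhoff by simp
qed

text \<open>Comparison with the barrier \<open>\<beta> * \<bar>m - 1\<bar>\<close>. Its slopes are at most \<open>\<beta> / \<Delta>x\<close>, so at a node away from
  the vertex the scheme is nearly evaluated at slope \<open>0\<close>; its minimum is placed at node \<open>1\<close> so that it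
  decreases away from the vertex, where it therefore cannot touch. Then \<open>\<beta>\<close> tends to \<open>0\<close>.\<close>

lemma upper_bound:
  assumes data: "\<And>i x. x \<le> 0 \<Longrightarrow> f i x - G i 0 0 \<le> M"
  shows "U z \<le> M"
proof (rule field_le_epsilon)
  fix e :: real assume "e > 0"
  obtain i0 n0 where z: "z = node i0 n0" by (rule grid_cases)
  have \<epsilon>: "\<epsilon> \<ge> 0"
    using L_nonneg \<Delta>x viscosity by (smt (verit) mult_nonneg_nonneg)
  have den: "real n0 + 1 + 2 * (\<epsilon> / \<Delta>x + L) / \<Delta>x > 0"
  proof (rule add_pos_nonneg)
    show "2 * (\<epsilon> / \<Delta>x + L) / \<Delta>x \<ge> 0" using \<epsilon> L_nonneg \<Delta>x by simp
  qed simp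
  define \<beta> where "\<beta> = e / (real n0 + 1 + 2 * (\<epsilon> / \<Delta>x + L) / \<Delta>x)"
  have \<beta>: "\<beta> > 0" using den \<open>e > 0\<close> by (simp add: \<beta>_def)
  define V where "V m = \<beta> * \<bar>real m - 1\<bar>" for m :: nat
  have "\<exists>N. \<forall>i. \<forall>m>N. V m \<ge> c" for c
  proof -
    obtain N :: nat where N: "c / \<beta> + 1 \<le> real N" using real_arch_simple by blast
    have "V m \<ge> c" if "m > N" for m
    proof -
      have "c / \<beta> \<le> \<bar>real m - 1\<bar>" using N that by linarith
      then show ?thesis using \<beta> by (simp add: V_def field_simps)
    qed
    then show ?thesis by blast
  qed
  then obtain j m where max: "\<And>i n. U (node i n) - V n \<le> U (node j m) - V m"
    using exists_max_minus_proper[of "\<lambda>_. V"] by blast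
  have "m \<ge> 1"
  proof (rule ccontr)
    assume "\<not> m \<ge> 1"
    then have "m = 0" by simp
    then have "(\<Sum>i\<in>(UNIV::'k set). V 0 - V 1) \<le> 0"
      using max[of _ 1] by (intro touching_vertex) (simp add: node_0)
    then show False using \<beta> by (simp add: V_def zero_less_card_finite mult_le_0_iff)
  qed
  let ?p1 = "(V (m - 1) - V m) / \<Delta>x" and ?p2 = "(V m - V (m + 1)) / \<Delta>x"
  have p: "\<bar>?p1\<bar> \<le> \<beta> / \<Delta>x" "\<bar>?p2\<bar> \<le> \<beta> / \<Delta>x"
  proof -
    have "\<bar>V a - V b\<bar> \<le> \<beta>" if "\<bar>real a - real b\<bar> \<le> 1" for a b
    proof -
      have "\<bar>V a - V b\<bar> = \<beta> * \<bar>\<bar>real a - 1\<bar> - \<bar>real b - 1\<bar>\<bar>"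
        using \<beta> by (simp add: V_def abs_mult flip: right_diff_distrib)
      also have "\<dots> \<le> \<beta> * 1" using \<beta> that by (intro mult_left_mono) auto
      finally show ?thesis by simp
    qed
    then have "\<bar>V (m - 1) - V m\<bar> \<le> \<beta>" "\<bar>V m - V (m + 1)\<bar> \<le> \<beta>"
      using \<open>m \<ge> 1\<close> by (simp_all add: of_nat_diff)
    then show "\<bar>?p1\<bar> \<le> \<beta> / \<Delta>x" "\<bar>?p2\<bar> \<le> \<beta> / \<Delta>x"
      using \<Delta>x by (simp_all add: divide_right_mono)
  qed
  have "numerical_flux \<Delta>x \<epsilon> G j ?p1 ?p2 \<ge> G j 0 0 - (\<epsilon> / \<Delta>x + L) * (2 * (\<beta> / \<Delta>x))"
  proof -
    have "?p1 - ?p2 \<le> 2 * (\<beta> / \<Delta>x)"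
      using p by linarith
    then have "\<epsilon> / \<Delta>x * (?p1 - ?p2) \<le> \<epsilon> / \<Delta>x * (2 * (\<beta> / \<Delta>x))"
      using \<epsilon> \<Delta>x by (intro mult_left_mono) auto
    moreover have "L * (\<bar>0 - ?p1\<bar> + \<bar>0 - ?p2\<bar>) \<le> L * (2 * (\<beta> / \<Delta>x))"
      using p L_nonneg by (intro mult_left_mono) auto
    ultimately show ?thesis
      using G_lipschitz[of j 0 0 ?p1 ?p2] unfolding numerical_flux_def
      by (simp only: distrib_right) linarith
  qed
  then have "U (node j m) \<le> M + (\<epsilon> / \<Delta>x + L) * (2 * (\<beta> / \<Delta>x))"
    using touching_edge[OF max \<open>m \<ge> 1\<close>] data[of "- real m * \<Delta>x" j] node_le_0[of m] by linarith
  moreover have "U z \<le> U (node j m) + \<beta> * (real n0 + 1)"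
  proof -
    have "V n0 \<le> \<beta> * (real n0 + 1)" "V m \<ge> 0"
      using \<beta> by (auto simp: V_def intro!: mult_left_mono)
    then show ?thesis using max[of i0 n0] by (simp add: z)
  qed
  moreover have "\<beta> * (real n0 + 1) + (\<epsilon> / \<Delta>x + L) * (2 * (\<beta> / \<Delta>x)) = e"
  proof -
    have "\<beta> * (real n0 + 1) + (\<epsilon> / \<Delta>x + L) * (2 * (\<beta> / \<Delta>x))
        = \<beta> * (real n0 + 1 + 2 * (\<epsilon> / \<Delta>x + L) / \<Delta>x)"
      by (simp add: algebra_simps)
    then show ?thesis using den by (simp add: \<beta>_def)
  qed
  ultimately show "U z \<le> M + e" by linarith
qed

text \<open>The barrier is the piecewise linear function that is \<open>0\<close> at the node \<open>m0\<close>, has slope \<open>P\<close> along the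
  edge of \<open>m0\<close>, and slope \<open>P / K\<close> (with \<open>K = CARD('k)\<close>) on the other edges. Between its kinks it is
  linear, so the flux there is \<open>G i p p\<close>, and the coercivity assumption \<open>steep\<close> forbids contact. At the
  vertex of the junction, if this is not \<open>m0\<close>, its differences sum to \<open>P - (K - 1) * P / K = P / K\<close> times \<open>\<Delta>x\<close>, which is
  positive: this is why coercivity is needed from slope \<open>P / K\<close> on. Contact is only possible at
  \<open>m0\<close> itself.\<close>

lemma linear_growth:
  fixes i0 :: 'k and m0 :: nat
  assumes "P > 0"
    and steep: "\<And>i p x. p \<in> {P, - P, - P / real CARD('k)} \<Longrightarrow> x \<le> 0 \<Longrightarrow> f i x - G i p p < l"
    and lower: "\<And>z. l \<le> U z"
  shows "U (node i0 n) \<le> U (node i0 m0) + P * \<Delta>x * \<bar>real n - real m0\<bar>"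
proof -
  let ?K = "real CARD('k)"
  have K: "?K > 0" by (simp add: zero_less_card_finite)
  define V where "V i m = (if i = i0 then P * \<Delta>x * \<bar>real m - real m0\<bar>
                           else P * \<Delta>x * real m0 + P / ?K * \<Delta>x * real m)" for i m
  have V0: "V i 0 = P * \<Delta>x * real m0" for i
    by (simp add: V_def)
  have "\<exists>N. \<forall>i. \<forall>m>N. V i m \<ge> c" for c
  proof -
    define d where "d = P / ?K * \<Delta>x"
    have d: "d > 0" using \<open>P > 0\<close> \<Delta>x K by (simp add: d_def)
    have dP: "d \<le> P * \<Delta>x"
    proof -
      have "P / ?K \<le> P / 1"
        using \<open>P > 0\<close> by (intro divide_left_mono) (auto simp: Suc_le_eq zero_less_card_finite)
      then show ?thesis unfolding d_def using \<Delta>x by (intro mult_right_mono) auto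
    qed
    have lower_V: "V i m \<ge> d * (real m - real m0)" for i m
    proof (cases "i = i0")
      case True
      have "d * (real m - real m0) \<le> d * \<bar>real m - real m0\<bar>" using d by simp
      also have "\<dots> \<le> P * \<Delta>x * \<bar>real m - real m0\<bar>" using dP by (intro mult_right_mono) auto
      finally show ?thesis using True by (simp add: V_def)
    next
      case False
      have "0 \<le> P * \<Delta>x * real m0" "0 \<le> d * real m0" using \<open>P > 0\<close> \<Delta>x d by auto
      moreover have "V i m = P * \<Delta>x * real m0 + d * real m" using False by (simp add: V_def d_def)
      ultimately show ?thesis by (simp add: right_diff_distrib)
    qed
    obtain N :: nat where N: "c / d + real m0 \<le> real N" using real_arch_simple by blast
    have "V i m \<ge> c" if "m > N" for i m
    proof -
      have "c / d \<le> real m - real m0" using N that by linarith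
      then have "c \<le> d * (real m - real m0)" using d by (simp add: field_simps)
      then show ?thesis using lower_V[of m i] by linarith
    qed
    then show ?thesis by blast
  qed
  then obtain j m where max: "\<And>i n. U (node i n) - V i n \<le> U (node j m) - V j m"
    using exists_max_minus_proper[of V] by blast
  have no_linear: False
    if "m \<ge> 1" "V j (m - 1) - V j m = p * \<Delta>x" "V j m - V j (m + 1) = p * \<Delta>x"
      "p \<in> {P, - P, - P / ?K}" for p
  proof -
    have quotient: "p * \<Delta>x / \<Delta>x = p" using \<Delta>x by simp
    show False
      using node_le_0[of m] touching_edge[OF max that(1)] steep[OF that(4), of "- real m * \<Delta>x" j]
        lower[of "node j m"]
      unfolding that(2,3) quotient flux_diagonal by linarith
  qed
  \<comment> \<open>Contact at the pole, at the vertex, or inside one of the linear pieces.\<close>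
  consider "m = 0" "m0 = 0" | "m = 0" "m0 > 0" | "j = i0" "m = m0" | "j = i0" "m \<ge> 1" "m < m0"
    | "j = i0" "m \<ge> 1" "m > m0" | "j \<noteq> i0" "m \<ge> 1"
    by fastforce
  then have "U (node j m) - V j m = U (node i0 m0)"
  proof cases
    case 2
    have "(\<Sum>i\<in>UNIV. V j 0 - V i 1) \<le> 0"
      using max[of _ 1] 2 by (intro touching_vertex) (simp add: node_0)
    moreover have "(\<Sum>i\<in>UNIV. V j 0 - V i 1) > 0"
    proof -
      have summand: "V j 0 - V i 1 = - P / ?K * \<Delta>x + (if i = i0 then P * \<Delta>x + P / ?K * \<Delta>x else 0)" for i
        using 2 unfolding V0 by (auto simp: V_def algebra_simps of_nat_diff)
      have "(\<Sum>i\<in>UNIV. V j 0 - V i 1) = ?K * (- P / ?K * \<Delta>x) + (P * \<Delta>x + P / ?K * \<Delta>x)"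
        unfolding summand sum.distrib by simp
      also have "\<dots> = P / ?K * \<Delta>x" using K by (simp add: field_simps)
      also have "\<dots> > 0" using \<open>P > 0\<close> K \<Delta>x by simp
      finally show ?thesis .
    qed
    ultimately show ?thesis by linarith
  next
    case 4
    then have "\<bar>real (m - 1) - real m0\<bar> = real m0 - real m + 1"
      "\<bar>real m - real m0\<bar> = real m0 - real m" "\<bar>real (m + 1) - real m0\<bar> = real m0 - real m - 1"
      by (auto simp: of_nat_diff)
    then have False
      using 4 by (intro no_linear[of P]) (simp_all only: V_def, simp_all add: algebra_simps)
    then show ?thesis ..
  next
    case 5
    then have "\<bar>real (m - 1) - real m0\<bar> = real m - real m0 - 1"
      "\<bar>real m - real m0\<bar> = real m - real m0" "\<bar>real (m + 1) - real m0\<bar> = real m - real m0 + 1"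
      by (auto simp: of_nat_diff)
    then have False
      using 5 by (intro no_linear[of "- P"]) (simp_all only: V_def, simp_all add: algebra_simps)
    then show ?thesis ..
  next
    case 6
    then have "real (m - 1) = real m - 1" "real (m + 1) = real m + 1"
      by (auto simp: of_nat_diff)
    then have False
      using 6 by (intro no_linear[of "- P / ?K"])
        (simp_all only: V_def, simp_all add: ring_distribs)
    then show ?thesis ..
  qed (simp_all add: V0 node_0, simp add: V_def)
  then show ?thesis
    using max[of i0 n] by (simp add: V_def)
qed

lemma difference_quotients_bounded:
  assumes "P > 0"
    and "\<And>i p x. p \<in> {P, - P, - P / real CARD('k)} \<Longrightarrow> x \<le> 0 \<Longrightarrow> f i x - G i p p < l"
    and "\<And>z. l \<le> U z"
  shows "\<bar>U (node i n) - U (node i (n + 1))\<bar> \<le> P * \<Delta>x"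
  using linear_growth[OF assms, of i n "n + 1"] linear_growth[OF assms, of i "n + 1" n]
  by (simp add: algebra_simps abs_le_iff)

end

lemma monotone_scheme_uminus:
  assumes "monotone_scheme \<Delta>x \<epsilon> L G f U"
  shows "monotone_scheme \<Delta>x \<epsilon> L (\<lambda>i p1 p2. - G i (- p1) (- p2)) (\<lambda>i x. - f i x) (\<lambda>z. - U z)"
proof -
  interpret monotone_scheme \<Delta>x \<epsilon> L G f U by (rule assms)
  show ?thesis
  proof
    fix i p1 p2 q1 q2
    show "\<bar>- G i (- p1) (- p2) - - G i (- q1) (- q2)\<bar> \<le> L * (\<bar>p1 - q1\<bar> + \<bar>p2 - q2\<bar>)"
      using G_lipschitz[of i "- p1" "- p2" "- q1" "- q2"] by (simp add: abs_minus_commute)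
  next
    have quotients: "diff_plus \<Delta>x (\<lambda>z. - U z) i m = - diff_plus \<Delta>x U i m"
         "diff_minus \<Delta>x (\<lambda>z. - U z) i m = - diff_minus \<Delta>x U i m" for i m
      by (simp_all add: diff_plus_def diff_minus_def diff_divide_distrib)
    have flux: "numerical_flux \<Delta>x \<epsilon> (\<lambda>i p1 p2. - G i (- p1) (- p2)) i (- p1) (- p2)
        = - numerical_flux \<Delta>x \<epsilon> G i p1 p2" for i p1 p2
      by (simp add: numerical_flux_def ring_distribs)
    have "- U (node i m) - numerical_flux \<Delta>x \<epsilon> G i (diff_plus \<Delta>x U i m) (diff_minus \<Delta>x U i m)
        = - f i (- real m * \<Delta>x)" if "m \<ge> 1" for i m
      using scheme_edge[OF that, of i] by linarith
    moreover have "U grid_origin = (1 / real CARD('a)) * (\<Sum>i\<in>UNIV. U (node i 1))"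
      using scheme by (simp add: scheme_solution_def)
    ultimately show "scheme_solution \<Delta>x \<epsilon> (\<lambda>i p1 p2. - G i (- p1) (- p2)) (\<lambda>i x. - f i x) (\<lambda>z. - U z)"
      unfolding scheme_solution_def quotients flux by (simp add: sum_negf)
  next
    show "bounded (range (\<lambda>z. - U z))"
      using bounded by (simp add: bounded_iff)
  qed (use \<Delta>x viscosity in auto)
qed

section \<open>Upper bounds for subsolutions\<close>

text \<open>The second argument is a further discrete variable: an edge in the bound on subsolutions, a node in
  the doubling of variables.\<close>

lemma attains_max_half_line:
  fixes \<Phi> :: "real \<Rightarrow> 'b \<Rightarrow> real"
  assumes cont: "\<And>b. continuous_on {..0} (\<lambda>x. \<Phi> x b)"
    and "finite F" and "b0 \<in> F" and "R \<ge> 0"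
    and far: "\<And>x b. x \<le> 0 \<Longrightarrow> x < - R \<or> b \<notin> F \<Longrightarrow> \<Phi> x b \<le> \<Phi> 0 b0"
  obtains x b where "x \<le> 0" "\<And>y c. y \<le> 0 \<Longrightarrow> \<Phi> y c \<le> \<Phi> x b"
proof -
  have "\<exists>x\<in>{-R..0}. \<forall>y\<in>{-R..0}. \<Phi> y b \<le> \<Phi> x b" for b
    by (rule continuous_attains_sup)
      (use \<open>R \<ge> 0\<close> in \<open>auto intro: continuous_on_subset[OF cont]\<close>)
  then obtain X where X: "\<And>b. X b \<in> {-R..0}" "\<And>b y. y \<in> {-R..0} \<Longrightarrow> \<Phi> y b \<le> \<Phi> (X b) b"
    by metis
  have "Max ((\<lambda>b. \<Phi> (X b) b) ` F) \<in> (\<lambda>b. \<Phi> (X b) b) ` F"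
    using \<open>finite F\<close> \<open>b0 \<in> F\<close> by (intro Max_in) auto
  then obtain b where b: "Max ((\<lambda>b. \<Phi> (X b) b) ` F) = \<Phi> (X b) b"
    by (rule imageE) simp
  have max: "\<Phi> (X c) c \<le> \<Phi> (X b) b" if "c \<in> F" for c
    unfolding b[symmetric] using that \<open>finite F\<close> by (intro Max_ge) auto
  have "\<Phi> y c \<le> \<Phi> (X b) b" if "y \<le> 0" for y c
  proof (cases "y < - R \<or> c \<notin> F")
    case True
    have "\<Phi> y c \<le> \<Phi> 0 b0" using far[OF that True] .
    also have "\<dots> \<le> \<Phi> (X b0) b0" using X(2) \<open>R \<ge> 0\<close> by simp
    also have "\<dots> \<le> \<Phi> (X b) b" using max[OF \<open>b0 \<in> F\<close>] .
    finally show ?thesis .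
  next
    case False
    then have "\<Phi> y c \<le> \<Phi> (X c) c" using X(2) that by simp
    also have "\<dots> \<le> \<Phi> (X b) b" using max False by simp
    finally show ?thesis .
  qed
  then show thesis using that[of "X b" b] X(1)[of b] by simp
qed

lemma continuous_on_edge:
  assumes "continuous_on UNIV u"
  shows "continuous_on {..0} (\<lambda>x. u (edge_point i x))"
proof -
  have "1-lipschitz_on {..0} (edge_point i)"
    by (intro lipschitz_onI) (auto simp: dist_edge_point dist_real_def)
  then show ?thesis
    by (intro continuous_on_compose2[OF assms lipschitz_on_continuous_on]) auto
qed

text \<open>Comparison with \<open>\<beta> * (x + 1)\<^sup>2\<close> on every edge, with \<open>\<beta>\<close> tending to \<open>0\<close>. The boundedness of \<open>u\<close>
  confines the maximum to the region where this parabola is at most \<open>2 * B + \<beta>\<close>, and there its slope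
  is of order \<open>sqrt \<beta>\<close>. The shift by \<open>1\<close> makes the slopes at the vertex positive, which excludes the
  Kirchhoff alternative.\<close>

lemma subsolution_upper_bound:
  fixes H :: "'k::finite \<Rightarrow> real \<Rightarrow> real" and u :: "'k junction \<Rightarrow> real"
  assumes sub: "viscosity_subsolution (separated H f) u" and bdd: "bounded (range u)"
    and lip: "\<And>i p. \<bar>p\<bar> \<le> 1 \<Longrightarrow> \<bar>H i p - H i 0\<bar> \<le> \<Lambda> * \<bar>p\<bar>"
    and data: "\<And>i x. x \<le> 0 \<Longrightarrow> f i x - H i 0 \<le> M"
  shows "u z \<le> M"
proof (rule field_le_epsilon)
  fix e :: real assume "e > 0"
  obtain i0 x0 where z: "x0 \<le> 0" "z = edge_point i0 x0" by (rule junction_cases)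
  obtain B where B: "\<And>z. \<bar>u z\<bar> \<le> B" using bdd by (auto simp: bounded_iff)
  have B0: "B \<ge> 0" using B[of z] by linarith
  have \<Lambda>: "\<Lambda> \<ge> 0" using lip[of 1 undefined] by auto
  define \<eta> where "\<eta> = min 1 (e / (2 * (\<Lambda> + 1)))"
  have \<eta>: "\<eta> > 0" "\<eta> \<le> 1" "\<Lambda> * \<eta> \<le> e / 2"
  proof -
    show "\<eta> > 0" "\<eta> \<le> 1" using \<open>e > 0\<close> \<Lambda> by (auto simp: \<eta>_def)
    have "\<Lambda> * \<eta> \<le> (\<Lambda> + 1) * (e / (2 * (\<Lambda> + 1)))"
      using \<open>e > 0\<close> \<Lambda> by (intro mult_mono) (auto simp: \<eta>_def)
    also have "\<dots> = e / 2" using \<Lambda> by (simp add: field_simps)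
    finally show "\<Lambda> * \<eta> \<le> e / 2" .
  qed
  define \<beta> where "\<beta> = min (min 1 (\<eta>\<^sup>2 / (4 * (2 * B + 1)))) (e / (2 * ((x0 + 1)\<^sup>2 + 1)))"
  have \<beta>: "\<beta> > 0" "\<beta> \<le> 1" "\<beta> * (4 * (2 * B + 1)) \<le> \<eta>\<^sup>2" "\<beta> * (x0 + 1)\<^sup>2 \<le> e / 2"
  proof -
    have pos: "(x0 + 1)\<^sup>2 + 1 > 0" by (simp add: add_nonneg_pos)
    then show "\<beta> > 0" "\<beta> \<le> 1" using \<eta> B0 \<open>e > 0\<close> by (auto simp: \<beta>_def)
    have "\<beta> \<le> \<eta>\<^sup>2 / (4 * (2 * B + 1))" by (simp add: \<beta>_def)
    then show "\<beta> * (4 * (2 * B + 1)) \<le> \<eta>\<^sup>2" using B0 by (simp add: pos_le_divide_eq)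
    have "\<beta> \<le> e / (2 * ((x0 + 1)\<^sup>2 + 1))" by (simp add: \<beta>_def)
    then have "\<beta> * (2 * ((x0 + 1)\<^sup>2 + 1)) \<le> e" using pos by (subst (asm) pos_le_divide_eq) auto
    then show "\<beta> * (x0 + 1)\<^sup>2 \<le> e / 2" using \<open>\<beta> > 0\<close> by (simp add: ring_distribs)
  qed
  define \<Phi> where "\<Phi> x i = u (edge_point i x) - \<beta> * (x + 1)\<^sup>2" for x i
  define R where "R = 2 * B / \<beta> + 2"
  have "\<exists>x i. x \<le> 0 \<and> (\<forall>y\<le>0. \<forall>j. \<Phi> y j \<le> \<Phi> x i)"
  proof (rule attains_max_half_line[of \<Phi> UNIV undefined R])
    show "continuous_on {..0} (\<lambda>x. \<Phi> x i)" for i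
      unfolding \<Phi>_def using sub
      by (intro continuous_intros continuous_on_edge) (simp add: viscosity_subsolution_def)
    show "R \<ge> 0" using B0 \<beta> by (simp add: R_def)
    fix x i assume "x \<le> (0::real)" "x < - R \<or> i \<notin> (UNIV::'k set)"
    then have "- x > 2 * B / \<beta> + 2" by (simp add: R_def)
    moreover have "2 * B / \<beta> \<ge> 0" using B0 \<beta> by simp
    ultimately have 1: "2 * B / \<beta> + 1 \<le> - (x + 1)" "1 \<le> - (x + 1)" by linarith+
    have "2 * B / \<beta> + 1 \<le> (- (x + 1)) * (- (x + 1))"
      using mult_mono[OF 1(1) 1(2)] 1 by simp
    then have "\<beta> * (2 * B / \<beta> + 1) \<le> \<beta> * (x + 1)\<^sup>2"
      using \<beta> by (intro mult_left_mono) (auto simp: power2_eq_square algebra_simps)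
    then have "2 * B + \<beta> \<le> \<beta> * (x + 1)\<^sup>2" using \<beta> by (simp add: ring_distribs)
    then show "\<Phi> x i \<le> \<Phi> 0 undefined"
      using B[of "edge_point i x"] B[of "edge_point undefined 0"] by (simp add: \<Phi>_def)
  qed (blast | simp)+
  then obtain x i where x: "x \<le> 0" and max: "\<And>y j. y \<le> 0 \<Longrightarrow> \<Phi> y j \<le> \<Phi> x i" by blast
  have small: "u z' + H j q \<le> f j y \<Longrightarrow> \<bar>q\<bar> \<le> \<eta> \<Longrightarrow> y \<le> 0 \<Longrightarrow> u z' \<le> M + e / 2" for z' j q y
  proof -
    assume q: "u z' + H j q \<le> f j y" "\<bar>q\<bar> \<le> \<eta>" "y \<le> 0"
    have "\<Lambda> * \<bar>q\<bar> \<le> \<Lambda> * \<eta>" using q \<Lambda> by (intro mult_left_mono) auto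
    then show "u z' \<le> M + e / 2"
      using lip[of q j] data[OF q(3), of j] q \<eta> by linarith
  qed
  have slope: "\<bar>2 * \<beta> * (x + 1)\<bar> \<le> \<eta>" if "\<beta> * (x + 1)\<^sup>2 \<le> 2 * B + \<beta>" for x
  proof -
    have "(2 * \<beta> * (x + 1))\<^sup>2 = 4 * \<beta> * (\<beta> * (x + 1)\<^sup>2)" by (simp add: power2_eq_square)
    also have "\<dots> \<le> 4 * \<beta> * (2 * B + 1)" using that \<beta> by (intro mult_left_mono) auto
    also have "\<dots> \<le> \<eta>\<^sup>2" using \<beta> by (simp add: algebra_simps)
    finally show ?thesis using \<eta> by (simp add: abs_le_square_iff[symmetric])
  qed
  have "u (edge_point i x) \<le> M + e / 2"
  proof (cases "x = 0")
    case True
    then have org: "edge_point i x = origin" by (simp add: edge_point_0)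
    have "(\<Sum>i\<in>(UNIV::'k set). 2 * \<beta>) > 0" using \<beta> by (simp add: zero_less_card_finite)
    then obtain j where j: "u origin + H j (2 * \<beta>) \<le> f j 0"
      using max org True
      by (elim subsolution_vertex[OF sub, where a = "\<lambda>_. 2 * \<beta>" and b = "\<lambda>_. \<beta>", rotated])
        (auto simp: \<Phi>_def power2_eq_square algebra_simps)
    then show ?thesis
      using small[OF j] slope[of 0] B0 by (simp add: org)
  next
    case False
    then have "x < 0" using x by simp
    then have "u (edge_point i x) + H i (2 * \<beta> + 2 * \<beta> * x) \<le> f i x"
      using max[of _ i] by (intro subsolution_interior[OF sub])
        (auto simp: \<Phi>_def power2_eq_square algebra_simps)
    moreover have "\<bar>2 * \<beta> + 2 * \<beta> * x\<bar> \<le> \<eta>"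
    proof -
      have "\<beta> * (x + 1)\<^sup>2 \<le> 2 * B + \<beta>"
        using max[of 0 i] B[of "edge_point i x"] B[of "edge_point i 0"] by (simp add: \<Phi>_def)
      then show ?thesis using slope[of x] by (simp add: algebra_simps)
    qed
    ultimately show ?thesis using small x by blast
  qed
  moreover have "u z - e / 2 \<le> u (edge_point i x)"
  proof -
    have "0 \<le> \<beta> * (x + 1)\<^sup>2" using \<beta> by simp
    then show ?thesis using max[OF z(1), of i0] \<beta>(4) by (simp add: z(2) \<Phi>_def)
  qed
  ultimately show "u z \<le> M + e" by linarith
qed

section \<open>Comparison of a subsolution with the scheme\<close>

text \<open>The hypotheses are symmetric under change of sign of \<open>u\<close>, \<open>U\<close>, \<open>f\<close> and reflection of \<open>H\<close>, \<open>G\<close>. The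
  bound \<open>differences\<close> stands for coercivity, which is not preserved by this symmetry, and it controls
  all slopes at which \<open>u\<close> and \<open>U\<close> are compared.\<close>

locale scheme_comparison = monotone_scheme \<Delta>x \<epsilon> L G f U
  for \<Delta>x \<epsilon> L :: real and G :: "'k::finite \<Rightarrow> real \<Rightarrow> real \<Rightarrow> real" and f :: "'k \<Rightarrow> real \<Rightarrow> real"
    and U :: "'k grid \<Rightarrow> real" +
  fixes H :: "'k \<Rightarrow> real \<Rightarrow> real" and u :: "'k junction \<Rightarrow> real" and P \<Lambda> L\<^sub>2 :: real
  assumes subsolution: "viscosity_subsolution (separated H f) u"
    and bounded_u: "bounded (range u)"
    and P: "P > 0" and \<Lambda>: "\<Lambda> \<ge> 0" and L\<^sub>2: "L\<^sub>2 \<ge> 0"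
    and H_lipschitz: "\<bar>p\<bar> \<le> P + 1 \<Longrightarrow> \<bar>q\<bar> \<le> P + 1 \<Longrightarrow> \<bar>H i p - H i q\<bar> \<le> \<Lambda> * \<bar>p - q\<bar>"
    and f_lipschitz: "x \<le> 0 \<Longrightarrow> y \<le> 0 \<Longrightarrow> \<bar>f i x - f i y\<bar> \<le> \<Lambda> * \<bar>x - y\<bar>"
    and consistent: "\<bar>p\<bar> \<le> P + 1 \<Longrightarrow> G i p p = H i p"
    and fine: "\<Delta>x \<le> 1" and small_viscosity: "\<epsilon> \<le> L\<^sub>2 * \<Delta>x"
    and differences: "\<bar>U (node i n) - U (node i (n + 1))\<bar> \<le> P * \<Delta>x"
begin

definition \<delta> :: real where "\<delta> = sqrt \<Delta>x"

lemma \<delta>: "\<delta> > 0" "\<delta> \<le> 1" "\<delta> * \<delta> = \<Delta>x"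
  using \<Delta>x fine by (auto simp: \<delta>_def)

text \<open>The quadratic doubling penalty at scale \<open>\<delta>\<close> with an additional tilt \<open>s\<close>: as a function of
  \<open>z = x - y\<close> it has slope \<open>s + z / \<delta>\<close>. The tilt shifts the slope at which the two functions are
  compared, at the price of an error of order \<open>\<delta>\<close> only.\<close>

definition penalty :: "real \<Rightarrow> real \<Rightarrow> real" where
  "penalty s z = z\<^sup>2 / (2 * \<delta>) + s * z"

lemma penalty_scaled: "penalty s (\<delta> * r) = \<delta> * (r\<^sup>2 / 2 + s * r)"
  using \<delta>(1) by (simp add: penalty_def power2_eq_square field_simps)

lemma penalty_shift:
  "penalty s (w + \<delta> * r) = penalty s (\<delta> * r) + (s + r) * w + w\<^sup>2 / (2 * \<delta>)"
  using \<delta>(1) by (simp add: penalty_def power2_eq_square field_simps)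

definition error_const :: real where
  "error_const = (\<Lambda> + P) * (2 * P + 3) + L\<^sub>2 + L + (P + 1)\<^sup>2 + 1"

lemma U_lipschitz_vertex: "\<bar>U (node i m) - U grid_origin\<bar> \<le> P * (real m * \<Delta>x)"
proof (induction m)
  case (Suc m)
  then show ?case using differences[of i m] by (simp add: algebra_simps)
qed (simp add: node_0)

text \<open>At a maximum of the doubled function in the grid variable, the difference quotient of \<open>U\<close>
  towards the vertex is at least \<open>p - \<delta> / 2\<close> and the one away from it at most \<open>p + \<delta> / 2\<close>, where
  \<open>\<delta> / 2 = \<Delta>x / (2 * \<delta>)\<close>. As both lie between \<open>- P\<close> and \<open>P\<close>, this bounds \<open>p\<close> from both sides;
  monotonicity of the flux and consistency then replace the scheme by the Hamiltonian at \<open>p\<close>.\<close>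

lemma scheme_at_contact:
  assumes "m \<ge> 1"
    and p: "x + real m * \<Delta>x = \<delta> * (p - s)"
    and max: "\<And>n. - U (node i n) - penalty s (x + real n * \<Delta>x)
                 \<le> - U (node i m) - penalty s (x + real m * \<Delta>x)"
  shows "\<bar>p\<bar> \<le> P + \<delta> / 2"
    and "f i (- real m * \<Delta>x) - U (node i m) \<le> H i p + (L\<^sub>2 + L) * \<delta>"
proof -
  let ?p1 = "diff_plus \<Delta>x U i m" and ?p2 = "diff_minus \<Delta>x U i m"
  have left: "x + real (m - 1) * \<Delta>x = \<delta> * (p - s - \<delta>)"
    using p \<open>m \<ge> 1\<close> \<delta>(3) by (simp add: of_nat_diff algebra_simps)
  have right: "x + real (m + 1) * \<Delta>x = \<delta> * (p - s + \<delta>)"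
    using p \<delta>(3) by (simp add: algebra_simps)
  have "penalty s (\<delta> * (p - s)) - penalty s (\<delta> * (p - s - \<delta>)) = \<delta> * \<delta> * (p - \<delta> / 2)"
    unfolding penalty_scaled by (simp add: power2_eq_square field_simps)
  then have "U (node i (m - 1)) - U (node i m) \<ge> \<Delta>x * (p - \<delta> / 2)"
    using max[of "m - 1"] unfolding p left \<delta>(3) by linarith
  then have p1: "?p1 \<ge> p - \<delta> / 2"
    using \<Delta>x by (simp add: diff_plus_def pos_le_divide_eq mult.commute)
  have "penalty s (\<delta> * (p - s + \<delta>)) - penalty s (\<delta> * (p - s)) = \<delta> * \<delta> * (p + \<delta> / 2)"
    unfolding penalty_scaled by (simp add: power2_eq_square field_simps)
  then have "U (node i m) - U (node i (m + 1)) \<le> \<Delta>x * (p + \<delta> / 2)"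
    using max[of "m + 1"] unfolding p right \<delta>(3) by linarith
  then have p2: "?p2 \<le> p + \<delta> / 2"
    using \<Delta>x by (simp add: diff_minus_def pos_divide_le_eq mult.commute)
  have "?p1 \<le> P" "?p2 \<ge> - P"
    using differences[of i "m - 1"] differences[of i m] \<open>m \<ge> 1\<close> \<Delta>x
    by (auto simp: diff_plus_def diff_minus_def abs_le_iff pos_divide_le_eq pos_le_divide_eq)
  then show "\<bar>p\<bar> \<le> P + \<delta> / 2" using p1 p2 by linarith
  then have "G i p p = H i p" using \<delta>(2) by (intro consistent) linarith
  moreover have "\<bar>G i (p - \<delta> / 2) (p + \<delta> / 2) - G i p p\<bar> \<le> L * \<delta>"
    using G_lipschitz[of i "p - \<delta> / 2" "p + \<delta> / 2" p p] \<delta>(1) by simp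
  moreover have "\<epsilon> / \<Delta>x * \<delta> \<le> L\<^sub>2 * \<delta>"
    using small_viscosity \<Delta>x \<delta>(1) by (intro mult_right_mono) (auto simp: pos_divide_le_eq)
  moreover have "numerical_flux \<Delta>x \<epsilon> G i ?p1 ?p2 \<le> numerical_flux \<Delta>x \<epsilon> G i (p - \<delta> / 2) (p + \<delta> / 2)"
    by (rule flux_mono[OF p1 p2])
  ultimately show "f i (- real m * \<Delta>x) - U (node i m) \<le> H i p + (L\<^sub>2 + L) * \<delta>"
    using scheme_edge[OF \<open>m \<ge> 1\<close>, of i] by (simp add: numerical_flux_def distrib_right abs_le_iff)
qed

text \<open>The doubled function is \<open>u x - U y - penalty s (x - y)\<close>, with a small multiple of \<open>x\<^sup>2\<close> subtracted
  so that a maximum exists. The decisive choice is \<open>s\<close>, slightly below the first difference quotient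
  \<open>p\<^sub>1\<close> of \<open>U\<close> at the vertex: then \<open>y = 0\<close> cannot be maximal, since moving \<open>y\<close> to the first node
  increases the doubled function. If also \<open>x < 0\<close>, the equations for \<open>u\<close> and \<open>U\<close> are compared at
  nearly the same slope \<open>p\<close>, which gives the first alternative. If \<open>x = 0\<close>, maximality in \<open>x\<close> says that a parabola
  of slope \<open>p\<close> touches \<open>u\<close> from above at the vertex along this edge, while the scheme at \<open>y\<close> says that
  \<open>H i p\<close> is large; and \<open>p\<close> exceeds \<open>p\<^sub>1\<close> because \<open>y\<close> is at least one step away from the vertex.\<close>

lemma edge_alternative:
  fixes i :: 'k and m\<^sub>0 :: nat
  defines "D \<equiv> u (edge_point i (- real m\<^sub>0 * \<Delta>x)) - U (node i m\<^sub>0)"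
  obtains "D \<le> error_const * \<delta>"
  | p b where "D \<le> u origin - U grid_origin + error_const * \<delta>"
      "p \<ge> (U grid_origin - U (node i 1)) / \<Delta>x + \<delta> / 4"
      "\<And>x. x \<le> 0 \<Longrightarrow> u (edge_point i x) \<le> u origin + p * x + b * x\<^sup>2"
      "f i 0 - U grid_origin \<le> H i p + error_const * \<delta>"
proof -
  define p\<^sub>1 where "p\<^sub>1 = (U grid_origin - U (node i 1)) / \<Delta>x"
  \<comment> \<open>Any multiple of \<open>\<delta>\<close> strictly between \<open>1 / 2\<close> and \<open>1\<close> would do: more than \<open>1 / 2\<close> is needed for
    \<open>m \<ge> 1\<close>, less than \<open>1\<close> for \<open>p > p\<^sub>1\<close>.\<close>
  define s where "s = p\<^sub>1 - 3 / 4 * \<delta>"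
  have p\<^sub>1: "U grid_origin - U (node i 1) = \<delta> * \<delta> * p\<^sub>1"
    using \<Delta>x by (simp add: p\<^sub>1_def \<delta>(3))
  have "\<bar>p\<^sub>1\<bar> \<le> P"
    using differences[of i 0] \<Delta>x by (simp add: p\<^sub>1_def node_0 pos_divide_le_eq)
  then have s: "\<bar>s\<bar> \<le> P + 1" using \<delta> by (simp add: s_def)
  obtain B\<^sub>1 where B\<^sub>1: "\<And>z. \<bar>u z\<bar> \<le> B\<^sub>1" using bounded_u by (auto simp: bounded_iff)
  obtain B\<^sub>2 where B\<^sub>2: "\<And>z. \<bar>U z\<bar> \<le> B\<^sub>2" using bounded by (auto simp: bounded_iff)
  define T where "T = 2 * (B\<^sub>1 + B\<^sub>2) + s\<^sup>2 + 1"
  have B0: "B\<^sub>1 \<ge> 0" "B\<^sub>2 \<ge> 0" using B\<^sub>1[of undefined] B\<^sub>2[of undefined] by linarith+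
  then have T: "T \<ge> 1" by (simp add: T_def)
  \<comment> \<open>The first bound makes the slope \<open>2 * \<beta> * x\<close> at the maximum at most \<open>\<delta> / 2\<close>, the second makes the
    localising term at the given node at most \<open>\<delta>\<close>.\<close>
  define \<beta> where "\<beta> = min (\<delta>\<^sup>2 / (16 * T)) (\<delta> / ((real m\<^sub>0 * \<Delta>x)\<^sup>2 + 1))"
  have \<beta>: "\<beta> > 0" "\<beta> * (16 * T) \<le> \<delta>\<^sup>2" "\<beta> * (real m\<^sub>0 * \<Delta>x)\<^sup>2 \<le> \<delta>"
  proof -
    have pos: "(real m\<^sub>0 * \<Delta>x)\<^sup>2 + 1 > 0" by (simp add: add_nonneg_pos)
    then show "\<beta> > 0" using T \<delta> by (auto simp: \<beta>_def)
    have "\<beta> \<le> \<delta>\<^sup>2 / (16 * T)" by (simp add: \<beta>_def)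
    then show "\<beta> * (16 * T) \<le> \<delta>\<^sup>2" using T by (simp add: pos_le_divide_eq)
    have "\<beta> \<le> \<delta> / ((real m\<^sub>0 * \<Delta>x)\<^sup>2 + 1)" by (simp add: \<beta>_def)
    then have "\<beta> * ((real m\<^sub>0 * \<Delta>x)\<^sup>2 + 1) \<le> \<delta>" using pos by (subst (asm) pos_le_divide_eq) auto
    then show "\<beta> * (real m\<^sub>0 * \<Delta>x)\<^sup>2 \<le> \<delta>" using \<open>\<beta> > 0\<close> by (simp add: distrib_left)
  qed
  define \<Phi> where "\<Phi> x n = u (edge_point i x) - U (node i n) - penalty s (x + real n * \<Delta>x) - \<beta> * x\<^sup>2"
    for x n
  have penalty_lower: "penalty s z \<ge> z\<^sup>2 / 4 - s\<^sup>2" for z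
  proof -
    define r where "r = z / \<delta>"
    have z: "z = \<delta> * r" using \<delta> by (simp add: r_def)
    have "0 \<le> \<delta> * (r / 2 + s)\<^sup>2" using \<delta> by simp
    then have "penalty s z \<ge> \<delta> * (r\<^sup>2 / 4) - \<delta> * s\<^sup>2"
      unfolding z penalty_scaled by (simp add: power2_eq_square algebra_simps)
    moreover have "\<delta> * s\<^sup>2 \<le> 1 * s\<^sup>2" using \<delta> by (intro mult_right_mono) auto
    moreover have "z\<^sup>2 / 4 \<le> \<delta> * (r\<^sup>2 / 4)"
    proof -
      have "\<delta> * (\<delta> * r\<^sup>2) \<le> 1 * (\<delta> * r\<^sup>2)" using \<delta> by (intro mult_right_mono) auto
      then show ?thesis unfolding z by (simp add: power2_eq_square algebra_simps)
    qed
    ultimately show ?thesis by linarith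
  qed
  have \<Phi>_0: "\<Phi> 0 0 = u origin - U grid_origin"
    by (simp add: \<Phi>_def penalty_def node_0 edge_point_0)
  have \<Phi>_upper: "\<Phi> x n \<le> \<Phi> 0 0 + T - ((x + real n * \<Delta>x)\<^sup>2 / 4 + \<beta> * x\<^sup>2)" for x n
    using penalty_lower[of "x + real n * \<Delta>x"] B\<^sub>1[of "edge_point i x"] B\<^sub>2[of "node i n"]
      B\<^sub>1[of origin] B\<^sub>2[of grid_origin]
    unfolding \<Phi>_0 by (simp add: \<Phi>_def T_def)
  define R where "R = T / \<beta> + 1"
  obtain N :: nat where N: "(R + 4 * T) / \<Delta>x \<le> real N" using real_arch_simple by blast
  have "\<exists>x m. x \<le> 0 \<and> (\<forall>y\<le>0. \<forall>n. \<Phi> y n \<le> \<Phi> x m)"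
  proof (rule attains_max_half_line[of \<Phi> "{..N}" 0 R])
    show "continuous_on {..0} (\<lambda>x. \<Phi> x n)" for n
      unfolding \<Phi>_def penalty_def using subsolution \<delta>
      by (intro continuous_intros continuous_on_edge) (auto simp: viscosity_subsolution_def)
    show "R \<ge> 0" using T \<beta> by (simp add: R_def)
    fix x :: real and n assume "x \<le> 0" "x < - R \<or> n \<notin> {..N}"
    then consider "x < - R" | "- R \<le> x" "n > N" by force
    then have "T \<le> (x + real n * \<Delta>x)\<^sup>2 / 4 + \<beta> * x\<^sup>2"
    proof cases
      case 1
      have "T / \<beta> \<ge> 0" using T \<beta> by simp
      then have "(T / \<beta>) * 1 \<le> (- x) * (- x)"
        using 1 by (intro mult_mono) (auto simp: R_def)
      then have "\<beta> * (T / \<beta>) \<le> \<beta> * x\<^sup>2"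
        using \<beta> by (intro mult_left_mono) (auto simp: power2_eq_square)
      then show ?thesis using \<beta> by (simp add: add_increasing)
    next
      case 2
      have "(R + 4 * T) \<le> real N * \<Delta>x" using N \<Delta>x by (simp add: pos_divide_le_eq)
      also have "\<dots> \<le> real n * \<Delta>x" using 2 \<Delta>x by (intro mult_right_mono) auto
      finally have z: "x + real n * \<Delta>x \<ge> 4 * T" using 2 by linarith
      then have "4 * T * 1 \<le> (x + real n * \<Delta>x) * (x + real n * \<Delta>x)"
        using T by (intro mult_mono) auto
      moreover have "\<beta> * x\<^sup>2 \<ge> 0" using \<beta> by simp
      ultimately show ?thesis by (simp add: power2_eq_square)
    qed
    then show "\<Phi> x n \<le> \<Phi> 0 0" using \<Phi>_upper[of x n] by linarith
  qed (blast | simp)+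
  then obtain x m where x: "x \<le> 0" and max: "\<And>y n. y \<le> 0 \<Longrightarrow> \<Phi> y n \<le> \<Phi> x m" by blast
  define r where "r = (x + real m * \<Delta>x) / \<delta>"
  define p where "p = s + r"
  have r: "x + real m * \<Delta>x = \<delta> * r" using \<delta> by (simp add: r_def)
  have "m \<ge> 1"
  proof (rule ccontr)
    assume "\<not> m \<ge> 1"
    then have m: "m = 0" by simp
    then have "r \<le> 0" using x \<delta> by (simp add: r_def divide_nonpos_pos)
    have "x = \<delta> * r" "x + \<Delta>x = \<delta> * (r + \<delta>)" using r m \<delta>(3) by (simp_all add: distrib_left)
    then have "U grid_origin - U (node i 1) \<le> penalty s (\<delta> * (r + \<delta>)) - penalty s (\<delta> * r)"
      using max[OF x, of 1] m by (simp add: \<Phi>_def node_0)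
    also have "\<dots> = \<delta> * \<delta> * (r + s + \<delta> / 2)"
      unfolding penalty_scaled by (simp add: power2_eq_square algebra_simps)
    finally have "p\<^sub>1 \<le> r + s + \<delta> / 2" unfolding p\<^sub>1 using \<delta>(1) by simp
    then show False using \<open>r \<le> 0\<close> \<delta>(1) by (simp add: s_def)
  qed
  have contact: "x + real m * \<Delta>x = \<delta> * (p - s)" using r by (simp add: p_def)
  have "- U (node i n) - penalty s (x + real n * \<Delta>x)
      \<le> - U (node i m) - penalty s (x + real m * \<Delta>x)" for n
    using max[OF x, of n] by (simp add: \<Phi>_def)
  note at_contact = scheme_at_contact[OF \<open>m \<ge> 1\<close> contact this]
  have r_bound: "\<bar>r\<bar> \<le> 2 * P + 2" and p_bound: "\<bar>p\<bar> \<le> P + 1 / 2"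
    using at_contact(1) s \<delta>(2) by (auto simp: p_def)
  have "\<delta> * \<bar>r\<bar> \<le> \<delta> * (2 * P + 2)"
    using r_bound \<delta> by (intro mult_left_mono) auto
  then have gap: "\<bar>x + real m * \<Delta>x\<bar> \<le> (2 * P + 2) * \<delta>"
    unfolding r using \<delta> by (simp add: abs_mult mult.commute)
  have D: "D \<le> u (edge_point i x) - U (node i m) + ((P + 1)\<^sup>2 + 1) * \<delta>"
  proof -
    have "\<Phi> (- real m\<^sub>0 * \<Delta>x) m\<^sub>0 = D - \<beta> * (real m\<^sub>0 * \<Delta>x)\<^sup>2"
      by (simp add: \<Phi>_def D_def penalty_def)
    then have "D - \<delta> \<le> \<Phi> x m" using max[OF node_le_0, of m\<^sub>0 m\<^sub>0] \<beta>(3) by linarith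
    moreover have "\<beta> * x\<^sup>2 \<ge> 0" using \<beta> by simp
    moreover have "- penalty s (x + real m * \<Delta>x) \<le> (P + 1)\<^sup>2 * \<delta>"
    proof -
      have "0 \<le> \<delta> * ((r + s)\<^sup>2 + s\<^sup>2)" using \<delta> by simp
      then have "- penalty s (\<delta> * r) \<le> s\<^sup>2 * \<delta>"
        unfolding penalty_scaled by (simp add: power2_eq_square algebra_simps)
      also have "s\<^sup>2 \<le> (P + 1)\<^sup>2" using s P by (simp add: abs_le_square_iff[symmetric])
      finally show ?thesis using r \<delta> by (simp add: mult_right_mono)
    qed
    ultimately show ?thesis by (simp add: \<Phi>_def ring_distribs)
  qed
  have f_gap: "\<bar>f i x - f i (- real m * \<Delta>x)\<bar> \<le> \<Lambda> * ((2 * P + 2) * \<delta>)"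
  proof -
    have "\<bar>f i x - f i (- real m * \<Delta>x)\<bar> \<le> \<Lambda> * \<bar>x + real m * \<Delta>x\<bar>"
      using f_lipschitz[OF x node_le_0, of i m] by simp
    also have "\<dots> \<le> \<Lambda> * ((2 * P + 2) * \<delta>)" using gap \<Lambda> by (intro mult_left_mono)
    finally show ?thesis .
  qed
  have error_const: "error_const * \<delta> = \<Lambda> * ((2 * P + 2) * \<delta>) + \<Lambda> * \<delta> + P * ((2 * P + 2) * \<delta>) + P * \<delta>
      + (L\<^sub>2 + L) * \<delta> + ((P + 1)\<^sup>2 + 1) * \<delta>"
    by (simp add: error_const_def algebra_simps)
  have nonneg: "\<Lambda> * ((2 * P + 2) * \<delta>) \<ge> 0" "P * ((2 * P + 2) * \<delta>) \<ge> 0" "\<Lambda> * \<delta> \<ge> 0" "P * \<delta> \<ge> 0"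
    "(L\<^sub>2 + L) * \<delta> \<ge> 0" "((P + 1)\<^sup>2 + 1) * \<delta> \<ge> 0"
    using P \<Lambda> \<delta> L\<^sub>2 L_nonneg by auto
  show thesis
  proof (cases "x = 0")
    case False
    have "x < 0" using x False by simp
    \<comment> \<open>The test function for \<open>u\<close>, as a function of \<open>y\<close>, has slope \<open>p + 2 * \<beta> * x\<close> at \<open>x\<close>; it has to be
      written as a quadratic polynomial centred at the vertex.\<close>
    have slope: "penalty s (y + real m * \<Delta>x) = penalty s (x + real m * \<Delta>x)
        + p * (y - x) + (y - x)\<^sup>2 / (2 * \<delta>)" for y
    proof -
      have "y + real m * \<Delta>x = (y - x) + \<delta> * r" using r by simp
      then show ?thesis by (simp only: r p_def penalty_shift)
    qed
    have "u (edge_point i x) + H i ((p - x / \<delta>) + 2 * (1 / (2 * \<delta>) + \<beta>) * x) \<le> f i x"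
    proof (rule subsolution_interior[OF subsolution \<open>x < 0\<close>])
      fix y :: real assume "y \<le> 0"
      have "(p - x / \<delta>) * y + (1 / (2 * \<delta>) + \<beta>) * y\<^sup>2 - ((p - x / \<delta>) * x + (1 / (2 * \<delta>) + \<beta>) * x\<^sup>2)
          = p * (y - x) + (y - x)\<^sup>2 / (2 * \<delta>) + (\<beta> * y\<^sup>2 - \<beta> * x\<^sup>2)"
        using \<delta>(1) by (simp add: power2_eq_square field_simps)
      then show "u (edge_point i y) - ((p - x / \<delta>) * y + (1 / (2 * \<delta>) + \<beta>) * y\<^sup>2)
          \<le> u (edge_point i x) - ((p - x / \<delta>) * x + (1 / (2 * \<delta>) + \<beta>) * x\<^sup>2)"
        using max[OF \<open>y \<le> 0\<close>, of m] slope[of y] unfolding \<Phi>_def by linarith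
    qed
    moreover have "(p - x / \<delta>) + 2 * (1 / (2 * \<delta>) + \<beta>) * x = p + 2 * \<beta> * x"
      using \<delta> by (simp add: field_simps)
    ultimately have sub: "u (edge_point i x) + H i (p + 2 * \<beta> * x) \<le> f i x" by (simp only:)
    have small: "\<bar>2 * \<beta> * x\<bar> \<le> \<delta> / 2"
    proof -
      have "\<beta> * x\<^sup>2 \<le> T"
      proof -
        have "(x + real m * \<Delta>x)\<^sup>2 / 4 \<ge> 0" by simp
        then show ?thesis using \<Phi>_upper[of x m] max[of 0 0] by linarith
      qed
      then have "4 * \<beta> * (\<beta> * x\<^sup>2) \<le> 4 * \<beta> * T" using \<beta> by (intro mult_left_mono) auto
      also have "\<dots> \<le> (\<delta> / 2)\<^sup>2" using \<beta>(2) by (simp add: power_divide)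
      also have "4 * \<beta> * (\<beta> * x\<^sup>2) = (2 * \<beta> * x)\<^sup>2" by (simp add: power2_eq_square)
      finally show ?thesis using \<delta> by (simp add: abs_le_square_iff[symmetric])
    qed
    have "\<bar>H i p - H i (p + 2 * \<beta> * x)\<bar> \<le> \<Lambda> * \<delta>"
    proof -
      have "\<bar>H i p - H i (p + 2 * \<beta> * x)\<bar> \<le> \<Lambda> * \<bar>p - (p + 2 * \<beta> * x)\<bar>"
        using small p_bound \<delta>(2) by (intro H_lipschitz) linarith+
      also have "\<dots> \<le> \<Lambda> * \<delta>" using small \<Lambda> \<delta>(1) by (intro mult_left_mono) linarith+
      finally show ?thesis .
    qed
    then have "D \<le> error_const * \<delta>"
      using sub at_contact(2) f_gap D nonneg unfolding error_const by linarith
    then show thesis by (rule that(1))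
  next
    case True
    have edge: "u (edge_point i x) = u origin" using True by (simp add: edge_point_0)
    have U_gap: "\<bar>U (node i m) - U grid_origin\<bar> \<le> P * ((2 * P + 2) * \<delta>)"
    proof -
      have "real m * \<Delta>x \<le> (2 * P + 2) * \<delta>" using gap True by simp
      then have "P * (real m * \<Delta>x) \<le> P * ((2 * P + 2) * \<delta>)" using P by (intro mult_left_mono) auto
      then show ?thesis using U_lipschitz_vertex[of i m] by linarith
    qed
    show thesis
    proof (rule that(2)[of p "1 / (2 * \<delta>) + \<beta>"])
      show "D \<le> u origin - U grid_origin + error_const * \<delta>"
        using D U_gap nonneg unfolding edge error_const by linarith
      show "f i 0 - U grid_origin \<le> H i p + error_const * \<delta>"
        using at_contact(2) f_gap U_gap nonneg unfolding True error_const by linarith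
      \<comment> \<open>The contact node is not the vertex, which lifts \<open>p\<close> by \<open>\<delta>\<close> above \<open>s\<close>.\<close>
      have "\<delta> * r = \<delta> * (real m * \<delta>)" using True r \<delta>(3) by (simp add: mult_ac)
      then have "r = real m * \<delta>" using \<delta>(1) by simp
      also have "\<dots> \<ge> 1 * \<delta>" using \<open>m \<ge> 1\<close> \<delta>(1) by (intro mult_right_mono) auto
      finally show "p \<ge> (U grid_origin - U (node i 1)) / \<Delta>x + \<delta> / 4"
        by (simp add: p_def s_def p\<^sub>1_def)
      fix y :: real assume "y \<le> 0"
      have "real m * \<Delta>x = \<delta> * r" using r True by simp
      then have "penalty s (y + real m * \<Delta>x) - penalty s (real m * \<Delta>x) = p * y + y\<^sup>2 / (2 * \<delta>)"
        by (simp add: p_def penalty_shift)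
      then show "u (edge_point i y) \<le> u origin + p * y + (1 / (2 * \<delta>) + \<beta>) * y\<^sup>2"
        using max[OF \<open>y \<le> 0\<close>, of m] True by (simp add: \<Phi>_def edge_point_0 algebra_simps)
    qed
  qed
qed

text \<open>If \<open>u - U\<close> were large at the vertex, the second case of \<open>edge_alternative\<close> would hold on every edge.
  The resulting slopes \<open>p i\<close> touch \<open>u\<close> from above at the vertex, and their sum is positive because they
  exceed the difference quotients of \<open>U\<close>, whose sum vanishes by the discrete Kirchhoff condition. So
  the equation for \<open>u\<close> holds at the vertex on some edge, against the lower bound on \<open>H i (p i)\<close>.\<close>

lemma vertex_gap: "u origin - U grid_origin \<le> error_const * \<delta>"
proof (rule ccontr)
  assume contra: "\<not> u origin - U grid_origin \<le> error_const * \<delta>"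
  have "\<exists>p b. p \<ge> (U grid_origin - U (node i 1)) / \<Delta>x + \<delta> / 4 \<and>
      (\<forall>x\<le>0. u (edge_point i x) \<le> u origin + p * x + b * x\<^sup>2) \<and>
      f i 0 - U grid_origin \<le> H i p + error_const * \<delta>" for i
  proof (rule edge_alternative[of i 0])
    assume "u (edge_point i (- real 0 * \<Delta>x)) - U (node i 0) \<le> error_const * \<delta>"
    then show ?thesis using contra by (simp add: edge_point_0 node_0)
  qed blast
  then obtain p b where p: "\<And>i. p i \<ge> (U grid_origin - U (node i 1)) / \<Delta>x + \<delta> / 4"
    and touch: "\<And>i x. x \<le> 0 \<Longrightarrow> u (edge_point i x) \<le> u origin + p i * x + b i * x\<^sup>2"
    and high: "\<And>i. f i 0 - U grid_origin \<le> H i (p i) + error_const * \<delta>"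
    by metis
  have "0 < (\<Sum>i\<in>(UNIV :: 'k set). \<delta> / 4)"
    using \<delta>(1) by (simp add: zero_less_card_finite)
  also have "\<dots> = (\<Sum>i\<in>UNIV. (U grid_origin - U (node i 1)) / \<Delta>x + \<delta> / 4)"
    using kirchhoff by (simp add: sum.distrib flip: sum_divide_distrib)
  also have "\<dots> \<le> (\<Sum>i\<in>UNIV. p i)" by (intro sum_mono p)
  finally obtain i where "u origin + H i (p i) \<le> f i 0"
    using subsolution_vertex[OF subsolution touch] by blast
  then show False using high[of i] contra by linarith
qed

lemma gap: "u (edge_point i (- real m * \<Delta>x)) - U (node i m) \<le> 2 * error_const * sqrt \<Delta>x"
proof -
  have "error_const * \<delta> \<ge> 0"
    using \<delta> P \<Lambda> L\<^sub>2 L_nonneg by (simp add: error_const_def)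
  then show ?thesis
    unfolding \<delta>_def[symmetric] using vertex_gap
    by (rule_tac edge_alternative[of i m]) linarith+
qed

end

section \<open>Consequences of the standing assumptions\<close>

text \<open>The infimum in the definition of the Lipschitz constant is itself a Lipschitz constant, provided
  there is one.\<close>

lemma lipschitz_const_bound:
  assumes L: "L-lipschitz_on X g" and "x \<in> X" "y \<in> X"
  shows "dist (g x) (g y) \<le> lipschitz_const X g * dist x y"
proof (cases "x = y")
  case False
  then have d: "dist x y > 0" by simp
  have "dist (g x) (g y) / dist x y \<le> lipschitz_const X g"
    unfolding lipschitz_const_def
  proof (rule cInf_greatest)
    show "{L. L-lipschitz_on X g} \<noteq> {}" using L by blast
    fix K assume "K \<in> {L. L-lipschitz_on X g}"
    then have "dist (g x) (g y) \<le> K * dist x y"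
      using assms(2,3) by (auto dest: lipschitz_onD)
    then show "dist (g x) (g y) / dist x y \<le> K" using d by (simp add: pos_divide_le_eq)
  qed
  then show ?thesis using d by (simp add: pos_divide_le_eq)
qed simp

lemma numerical_lipschitz_const_bound:
  fixes G :: "'k::finite \<Rightarrow> real \<Rightarrow> real \<Rightarrow> real"
  assumes lip: "\<And>i. \<exists>L. L-lipschitz_on UNIV (\<lambda>(p1, p2). G i p1 p2)"
  shows "\<bar>G i p1 p2 - G i q1 q2\<bar> \<le> numerical_lipschitz_const G * (\<bar>p1 - q1\<bar> + \<bar>p2 - q2\<bar>)"
proof (cases "(p1, p2) = (q1, q2)")
  case False
  let ?S = "\<lambda>i. {\<bar>G i p1 p2 - G i q1 q2\<bar> / (\<bar>p1 - q1\<bar> + \<bar>p2 - q2\<bar>) |p1 p2 q1 q2. (p1, p2) \<noteq> (q1, q2)}"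
  obtain L where L: "L-lipschitz_on UNIV (\<lambda>(p1, p2). G i p1 p2)" using lip by blast
  have "\<bar>G i p1 p2 - G i q1 q2\<bar> / (\<bar>p1 - q1\<bar> + \<bar>p2 - q2\<bar>) \<le> L" if "(p1, p2) \<noteq> (q1, q2)"
    for p1 p2 q1 q2
  proof -
    have "\<bar>G i p1 p2 - G i q1 q2\<bar> \<le> L * dist (p1, p2) (q1, q2)"
      using lipschitz_onD[OF L, of "(p1, p2)" "(q1, q2)"] by (simp add: dist_real_def)
    also have "\<dots> \<le> L * (\<bar>p1 - q1\<bar> + \<bar>p2 - q2\<bar>)"
      using lipschitz_on_nonneg[OF L] sqrt_sum_squares_le_sum_abs[of "p1 - q1" "p2 - q2"]
      by (intro mult_left_mono) (auto simp: dist_Pair_Pair dist_real_def)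
    finally show ?thesis using that by (auto simp: pos_divide_le_eq add_pos_nonneg add_nonneg_pos)
  qed
  then have "bdd_above (?S i)" by (intro bdd_aboveI[of _ L]) auto
  then have "\<bar>G i p1 p2 - G i q1 q2\<bar> / (\<bar>p1 - q1\<bar> + \<bar>p2 - q2\<bar>) \<le> Sup (?S i)"
    using False by (intro cSup_upper) auto
  also have "\<dots> \<le> numerical_lipschitz_const G"
    unfolding numerical_lipschitz_const_def by (intro Max_ge) auto
  finally show ?thesis
    using False by (subst (asm) pos_divide_le_eq) (auto simp: add_pos_nonneg add_nonneg_pos)
qed simp

text \<open>For separated Hamiltonians, the Lipschitz constant in \<open>(x, p)\<close> bounds those of \<open>H i\<close> and \<open>f i\<close>
  separately, by fixing \<open>x\<close> or \<open>p\<close>. Boundedness of \<open>H i 0 - f i x\<close> makes \<open>source_sup f\<close> a genuine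
  supremum, as there are finitely many edges.\<close>

lemma admissible_dataD:
  fixes H f :: "'k::finite \<Rightarrow> real \<Rightarrow> real"
  assumes data: "admissible_data M L\<^sub>G P \<Lambda> H f G L\<^sub>c" and "P > 0"
  shows "\<And>i p q. \<bar>p\<bar> \<le> P + 1 \<Longrightarrow> \<bar>q\<bar> \<le> P + 1 \<Longrightarrow> \<bar>H i p - H i q\<bar> \<le> \<Lambda> i * \<bar>p - q\<bar>"
    and "\<And>i x y. x \<le> 0 \<Longrightarrow> y \<le> 0 \<Longrightarrow> \<bar>f i x - f i y\<bar> \<le> \<Lambda> i * \<bar>x - y\<bar>"
    and "\<And>i x. x \<le> 0 \<Longrightarrow> \<bar>H i 0 - f i x\<bar> \<le> M"
    and "\<And>i p x. \<bar>p\<bar> \<ge> P / real CARD('k) \<Longrightarrow> x \<le> 0 \<Longrightarrow> H i p \<ge> M + f i x + 1"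
    and "\<And>i p. \<bar>p\<bar> \<le> P + 1 \<Longrightarrow> G i p p = H i p"
    and "\<And>i p1 p2 q1 q2. \<bar>G i p1 p2 - G i q1 q2\<bar> \<le> L\<^sub>G * (\<bar>p1 - q1\<bar> + \<bar>p2 - q2\<bar>)"
proof -
  let ?X = "{..0} \<times> {-(P + 1)..P + 1}"
  note data' = data[unfolded admissible_data_def]
  have lip: "\<exists>L. L-lipschitz_on ?X (\<lambda>(x, p). separated H f i x p)" for i
    using data' \<open>P > 0\<close> unfolding locally_lipschitz_hamiltonians_def by (auto dest!: spec[of _ "P + 1"])
  have \<Lambda>: "\<Lambda> i = lipschitz_const ?X (\<lambda>(x, p). separated H f i x p)" for i
    using data' by (elim conjE) (erule spec)
  have bound: "\<bar>separated H f i x p - separated H f i y q\<bar> \<le> \<Lambda> i * dist (x, p) (y, q)"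
    if "x \<le> 0" "y \<le> 0" "\<bar>p\<bar> \<le> P + 1" "\<bar>q\<bar> \<le> P + 1" for i x y p q
  proof -
    obtain L where "L-lipschitz_on ?X (\<lambda>(x, p). separated H f i x p)" using lip by blast
    from lipschitz_const_bound[OF this, of "(x, p)" "(y, q)"] that show ?thesis
      unfolding \<Lambda> by (auto simp: dist_real_def abs_le_iff)
  qed
  show "\<bar>H i p - H i q\<bar> \<le> \<Lambda> i * \<bar>p - q\<bar>" if "\<bar>p\<bar> \<le> P + 1" "\<bar>q\<bar> \<le> P + 1" for i p q
    using bound[of 0 0 p q i] that by (simp add: separated_def dist_Pair_Pair dist_real_def)
  show "\<bar>f i x - f i y\<bar> \<le> \<Lambda> i * \<bar>x - y\<bar>" if "x \<le> 0" "y \<le> 0" for i x y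
    using bound[of x y 0 0 i] that \<open>P > 0\<close>
    by (simp add: separated_def dist_Pair_Pair dist_real_def abs_minus_commute)
  have bdd: "bdd_above (zero_slope_values (separated H f))"
    using data' by (elim conjE)
  have M: "M = Sup (zero_slope_values (separated H f))"
    using data' by (elim conjE)
  show zero: "\<bar>H i 0 - f i x\<bar> \<le> M" if "x \<le> 0" for i x
    unfolding M by (rule cSup_upper[OF _ bdd])
      (use that in \<open>auto simp: zero_slope_values_def separated_def\<close>)
  have source: "f i x \<le> source_sup f" if "x \<le> 0" for i x
  proof -
    have "\<bar>f j y\<bar> \<le> M + (\<Sum>i\<in>UNIV. \<bar>H i 0\<bar>)" if "y \<le> 0" for j y
      using zero[OF that, of j] member_le_sum[of j UNIV "\<lambda>i. \<bar>H i 0\<bar>"] by simp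
    then have "bdd_above {\<bar>f j x\<bar> |j x. x \<le> 0}"
      by (intro bdd_aboveI[of _ "M + (\<Sum>i\<in>UNIV. \<bar>H i 0\<bar>)"]) auto
    then have "\<bar>f i x\<bar> \<le> source_sup f"
      unfolding source_sup_def using that by (intro cSup_upper) auto
    then show ?thesis by simp
  qed
  show "H i p \<ge> M + f i x + 1" if "\<bar>p\<bar> \<ge> P / real CARD('k)" "x \<le> 0" for i p x
  proof -
    have "H i p \<ge> M + source_sup f + 1" using data' that(1) by blast
    then show ?thesis using source[OF that(2), of i] by linarith
  qed
  show "G i p p = H i p" if "\<bar>p\<bar> \<le> P + 1" for i p
  proof -
    have "p \<in> {-L\<^sub>c..L\<^sub>c}" using data' that by auto
    then show ?thesis using data' by blast
  qed
  show "\<bar>G i p1 p2 - G i q1 q2\<bar> \<le> L\<^sub>G * (\<bar>p1 - q1\<bar> + \<bar>p2 - q2\<bar>)" for i p1 p2 q1 q2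
    using data' numerical_lipschitz_const_bound[of G i p1 p2 q1 q2] by auto
qed

section \<open>The error estimate\<close>

text \<open>The one-sided comparison is applied to \<open>(u, U)\<close> and to \<open>(- u, - U)\<close>. The bound on the difference
  quotients is derived before changing sign, since it rests on coercivity.\<close>

lemma fine_grid_estimate:
  fixes H f :: "'k::finite \<Rightarrow> real \<Rightarrow> real"
  assumes data: "admissible_data M L\<^sub>G P \<Lambda> H f G L\<^sub>c" and "P > 0" "L\<^sub>2 > 0"
    and mesh: "\<Delta>x > 0" "2 * L\<^sub>G * \<Delta>x \<le> \<epsilon>" "\<epsilon> \<le> L\<^sub>2 * \<Delta>x"
    and u: "viscosity_solution (separated H f) u" "bounded (range u)"
    and U: "scheme_solution \<Delta>x \<epsilon> G f U" "bounded (range U)"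
  defines "\<Lambda>\<^sub>0 \<equiv> \<Sum>i\<in>UNIV. \<bar>\<Lambda> i\<bar>"
  shows "\<bar>u z\<bar> \<le> M" and "\<bar>U w\<bar> \<le> M"
    and "\<Delta>x \<le> 1 \<Longrightarrow> \<bar>U (node i m) - u (edge_point i (- real m * \<Delta>x))\<bar>
           \<le> 2 * ((\<Lambda>\<^sub>0 + P) * (2 * P + 3) + L\<^sub>2 + L\<^sub>G + (P + 1)\<^sup>2 + 1) * sqrt \<Delta>x"
proof -
  note D = admissible_dataD[OF data \<open>P > 0\<close>]
  let ?H = "\<lambda>i p. - H i (- p)" and ?f = "\<lambda>i x. - f i x" and ?G = "\<lambda>i p1 p2. - G i (- p1) (- p2)"
    and ?u = "\<lambda>z. - u z" and ?U = "\<lambda>z. - U z"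
  have sub: "viscosity_subsolution (separated H f) u" and sup: "viscosity_subsolution (separated ?H ?f) ?u"
    using u(1) supersolution_uminus by (auto simp: viscosity_solution_def)
  have bdd: "bounded (range ?u)" using u(2) by (simp add: bounded_iff)
  have L\<^sub>G: "L\<^sub>G \<ge> 0" using D(6)[of undefined 1 0 0 0] by simp
  then have visc: "L\<^sub>G * \<Delta>x \<le> \<epsilon>" using mesh mult_nonneg_nonneg[of L\<^sub>G \<Delta>x] by linarith
  interpret S: monotone_scheme \<Delta>x \<epsilon> L\<^sub>G G f U
    using D(6) U mesh(1) visc by unfold_locales auto
  interpret S': monotone_scheme \<Delta>x \<epsilon> L\<^sub>G ?G ?f ?U
    by (rule monotone_scheme_uminus) (rule S.monotone_scheme_axioms)
  have G0: "G i 0 0 = H i 0" for i using D(5)[of 0 i] \<open>P > 0\<close> by simp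
  have data0: "f i x - H i 0 \<le> M" "- f i x - - H i 0 \<le> M" if "x \<le> 0" for i x
    using D(3)[OF that, of i] by (simp_all add: abs_le_iff)
  have U_le: "U z \<le> M" "- U z \<le> M" for z
    using S.upper_bound[of M z] S'.upper_bound[of M z] data0 by (simp_all add: G0)
  show "\<bar>U w\<bar> \<le> M" using U_le[of w] by simp
  have \<Lambda>: "\<Lambda> i \<le> \<Lambda>\<^sub>0" for i
    unfolding \<Lambda>\<^sub>0_def using member_le_sum[of i UNIV "\<lambda>i. \<bar>\<Lambda> i\<bar>"] by simp
  have \<Lambda>0: "\<Lambda>\<^sub>0 \<ge> 0" unfolding \<Lambda>\<^sub>0_def by (simp add: sum_nonneg)
  have H_lip: "\<bar>H i p - H i q\<bar> \<le> \<Lambda>\<^sub>0 * \<bar>p - q\<bar>" if "\<bar>p\<bar> \<le> P + 1" "\<bar>q\<bar> \<le> P + 1" for i p q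
    by (rule order_trans[OF D(1)[OF that] mult_right_mono[OF \<Lambda>]]) simp
  have f_lip: "\<bar>f i x - f i y\<bar> \<le> \<Lambda>\<^sub>0 * \<bar>x - y\<bar>" if "x \<le> 0" "y \<le> 0" for i x y
    by (rule order_trans[OF D(2)[OF that] mult_right_mono[OF \<Lambda>]]) simp
  have "u z \<le> M"
    by (rule subsolution_upper_bound[OF sub u(2), of \<Lambda>\<^sub>0])
      (use H_lip[of _ 0] data0 \<open>P > 0\<close> in auto)
  moreover have "- u z \<le> M"
  proof (rule subsolution_upper_bound[OF sup bdd, of \<Lambda>\<^sub>0])
    show "\<bar>- H i (- p) - - H i (- 0)\<bar> \<le> \<Lambda>\<^sub>0 * \<bar>p\<bar>" if "\<bar>p\<bar> \<le> 1" for i p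
      using H_lip[of "- p" 0 i] that \<open>P > 0\<close> by (simp add: abs_minus_commute)
  qed (use data0 in auto)
  ultimately show "\<bar>u z\<bar> \<le> M" by simp
  have K: "P / real CARD('k) \<le> P" "P / real CARD('k) > 0"
    using \<open>P > 0\<close> by (simp_all add: pos_divide_le_eq Suc_le_eq zero_less_card_finite)
  have differences: "\<bar>U (node i n) - U (node i (n + 1))\<bar> \<le> P * \<Delta>x" for i n
  proof (rule S.difference_quotients_bounded[OF \<open>P > 0\<close>])
    show "- M \<le> U z" for z using U_le[of z] by simp
    fix i :: 'k and p x :: real
    assume p: "p \<in> {P, - P, - P / real CARD('k)}" and "x \<le> 0"
    then have "\<bar>p\<bar> \<le> P + 1" "\<bar>p\<bar> \<ge> P / real CARD('k)" using K by auto
    then show "f i x - G i p p < - M" using D(4)[OF _ \<open>x \<le> 0\<close>, of p i] D(5)[of p i] by simp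
  qed
  assume fine: "\<Delta>x \<le> 1"
  interpret C: scheme_comparison \<Delta>x \<epsilon> L\<^sub>G G f U H u P \<Lambda>\<^sub>0 L\<^sub>2
    using sub u(2) \<open>P > 0\<close> \<Lambda>0 \<open>L\<^sub>2 > 0\<close> H_lip f_lip D(5) fine mesh differences
    by unfold_locales auto
  interpret C': scheme_comparison \<Delta>x \<epsilon> L\<^sub>G ?G ?f ?U ?H ?u P \<Lambda>\<^sub>0 L\<^sub>2
  proof
    show "\<bar>- H i (- p) - - H i (- q)\<bar> \<le> \<Lambda>\<^sub>0 * \<bar>p - q\<bar>" if "\<bar>p\<bar> \<le> P + 1" "\<bar>q\<bar> \<le> P + 1" for i p q
      using H_lip[of "- p" "- q" i] that by (simp add: abs_minus_commute)
    show "\<bar>- f i x - - f i y\<bar> \<le> \<Lambda>\<^sub>0 * \<bar>x - y\<bar>" if "x \<le> 0" "y \<le> 0" for i x y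
      using f_lip[OF that, of i] by (simp add: abs_minus_commute)
    show "- G i (- p) (- p) = - H i (- p)" if "\<bar>p\<bar> \<le> P + 1" for i p
      using D(5)[of "- p" i] that by simp
    show "\<bar>- U (node i n) - - U (node i (n + 1))\<bar> \<le> P * \<Delta>x" for i n
      using differences[of i n] by (simp add: abs_minus_commute)
  qed (use sup bdd \<open>P > 0\<close> \<Lambda>0 \<open>L\<^sub>2 > 0\<close> fine mesh in auto)
  show "\<bar>U (node i m) - u (edge_point i (- real m * \<Delta>x))\<bar>
      \<le> 2 * ((\<Lambda>\<^sub>0 + P) * (2 * P + 3) + L\<^sub>2 + L\<^sub>G + (P + 1)\<^sup>2 + 1) * sqrt \<Delta>x"
    using C.gap[of i m] C'.gap[of i m] unfolding C.error_const_def C'.error_const_def by linarith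
qed

theorem theorem3:
  fixes M L\<^sub>G L\<^sub>2 Lbar :: real and \<Lambda> :: "'k::finite \<Rightarrow> real"
  assumes "L\<^sub>2 > 0" and "Lbar > 0"
  shows "\<exists>C>0. \<forall>(H :: 'k \<Rightarrow> real \<Rightarrow> real) (f :: 'k \<Rightarrow> real \<Rightarrow> real)
             (G :: 'k \<Rightarrow> real \<Rightarrow> real \<Rightarrow> real) (L\<^sub>c :: real).
           admissible_data M L\<^sub>G Lbar \<Lambda> H f G L\<^sub>c \<longrightarrow>
           (\<forall>\<Delta>x>0. \<forall>\<epsilon>>0. 2 * L\<^sub>G * \<Delta>x \<le> \<epsilon> \<and> \<epsilon> \<le> L\<^sub>2 * \<Delta>x \<longrightarrow>
             (\<forall>(u :: 'k junction \<Rightarrow> real) (U :: 'k grid \<Rightarrow> real).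
                viscosity_solution (separated H f) u \<and> bounded (range u) \<and>
                scheme_solution \<Delta>x \<epsilon> G f U \<and> bounded (range U) \<longrightarrow>
                (SUP (i, m). \<bar>U (node i m) - u (edge_point i (- real m * \<Delta>x))\<bar>) \<le> C * sqrt \<Delta>x))"
proof -
  define C\<^sub>0 where "C\<^sub>0 = 2 * (((\<Sum>i\<in>UNIV. \<bar>\<Lambda> i\<bar>) + Lbar) * (2 * Lbar + 3) + L\<^sub>2 + L\<^sub>G
    + (Lbar + 1)\<^sup>2 + 1)"
  define C where "C = \<bar>C\<^sub>0\<bar> + 2 * \<bar>M\<bar> + 1"
  \<comment> \<open>On coarse grids, where \<open>sqrt \<Delta>x \<ge> 1\<close>, the a priori bounds \<open>\<bar>u\<bar> \<le> M\<close> and \<open>\<bar>U\<bar> \<le> M\<close> suffice.\<close>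
  have "\<bar>U (node i m) - u (edge_point i (- real m * \<Delta>x))\<bar> \<le> C * sqrt \<Delta>x"
    if data: "admissible_data M L\<^sub>G Lbar \<Lambda> H f G L\<^sub>c"
      and mesh: "\<Delta>x > 0" "2 * L\<^sub>G * \<Delta>x \<le> \<epsilon>" "\<epsilon> \<le> L\<^sub>2 * \<Delta>x"
      and sol: "viscosity_solution (separated H f) u" "bounded (range u)"
        "scheme_solution \<Delta>x \<epsilon> G f U" "bounded (range U)"
    for H f G L\<^sub>c \<Delta>x \<epsilon> and u :: "'k junction \<Rightarrow> real" and U :: "'k grid \<Rightarrow> real" and i m
  proof (cases "\<Delta>x \<le> 1")
    case True
    have "C\<^sub>0 * sqrt \<Delta>x \<le> C * sqrt \<Delta>x"
      using mesh(1) by (intro mult_right_mono) (auto simp: C_def)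
    then show ?thesis
      using fine_grid_estimate(3)[OF data assms(2,1) mesh sol True, of i m]
      unfolding C\<^sub>0_def by linarith
  next
    case False
    have "\<bar>U (node i m) - u (edge_point i (- real m * \<Delta>x))\<bar> \<le> 2 * \<bar>M\<bar>"
      using fine_grid_estimate(1)[OF data assms(2,1) mesh sol, of "edge_point i (- real m * \<Delta>x)"]
        fine_grid_estimate(2)[OF data assms(2,1) mesh sol, of "node i m"] by linarith
    also have "\<dots> \<le> C * 1" by (simp add: C_def)
    also have "\<dots> \<le> C * sqrt \<Delta>x" using False by (intro mult_left_mono) (auto simp: C_def)
    finally show ?thesis .
  qed
  moreover have "C > 0" by (simp add: C_def add_nonneg_pos)
  ultimately show ?thesis
    by (intro exI[of _ C] conjI allI impI cSUP_least) auto
qed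

end
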